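(* Let $M$ be a smooth manifold and let $\mathfrak{a}\subset\mathcal{E}(M)$ be a weakly Łojasiewicz ideal. If $\mathfrak{a}$ is saturated, then $\mathcal{I}(\mathcal{Z}(\mathfrak{a}))=\widetilde{\sqrt[\text{Ł}]{\mathfrak{a}}}$. If $\mathfrak{a}$ is not saturated, then $\mathcal{I}(\mathcal{Z}(\mathfrak{a}))=\widetilde{\sqrt[\text{Ł}]{\widetilde{\mathfrak{a}}}}$.
   Context: $\mathcal{E}(M)$ is the algebra of real-valued $C^\infty$ functions on the smooth manifold $M$; $\mathcal{E}_x$ is the ring of germs at $x$ of smooth functions and $g_x$ is the germ of $g$ at $x$. The saturation of an ideal $\mathfrak{b}\subset\mathcal{E}(M)$ is $\widetilde{\mathfrak{b}}=\{g\in\mathcal{E}(M): g_x\in\mathfrak{b}\mathcal{E}_x\ \forall x\in M\}$; $\mathfrak{b}$ is saturated if $\mathfrak{b}=\widetilde{\mathfrak{b}}$. The Łojasiewicz radical of $\mathfrak{b}$ is the ideal $\sqrt[\text{Ł}]{\mathfrak{b}}=\{g\in\mathcal{E}(M):\exists f\in\mathfrak{b},\ \exists m\ge 1\text{ integer with } f-g^{2m}\ge 0\text{ on }M\}$. $\mathcal{Z}(\mathfrak{a})$ is the common zero set of $\mathfrak{a}$ in $M$, and $\mathcal{I}(X)$ is the ideal of all $g\in\mathcal{E}(M)$ vanishing on $X\subset M$. Fix a distance $d$ on $M$ inducing its topology and locally equivalent to the Euclidean distance in charts; $d(x,X)=\inf_{y\in X}d(x,y)$, with the convention $d(x,\varnothing)=1$.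 For $U\subset M$ open, $\mathfrak{a}\,\mathcal{E}(U)$ is the ideal of $\mathcal{E}(U)$ generated by the restrictions to $U$ of elements of $\mathfrak{a}$. An ideal $\mathfrak{a}\subset\mathcal{E}(M)$ is weakly Łojasiewicz if (i) it is locally finitely generated: for every $x\in M$ there are an open neighborhood $U$ of $x$ and finitely many elements of $\mathfrak{a}$ whose restrictions generate $\mathfrak{a}\,\mathcal{E}(U)$; and (ii) there is $f\in\widetilde{\mathfrak{a}}$ such that for every compact $K\subset M$ there are a constant $c>0$ and a positive integer $m$ with $|f(x)|\ge c\,d(x,\mathcal{Z}(\mathfrak{a}))^m$ for all $x\in K$. *)

theory Defs
  imports "HOL-Analysis.Analysis" "HOL-Algebra.Ideal"
begin

section \<open>Smooth maps between Euclidean spaces\<close>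

text \<open>
  The role of \<open>\<real>\<^sup>n\<close> is played by an \<open>n\<close>-dimensional linear subspace \<open>V\<close> of a type of class
  \<open>euclidean_space\<close>. Such types have dimension at least 1, so a subspace is needed to
  include \<open>n = 0\<close>; for \<open>V = UNIV\<close> one gets the usual notions.

  The set \<open>W\<close> is meant to be open in \<open>V\<close>. Then \<open>f' x\<close> is uniquely determined on \<open>V\<close>
  (though not outside \<open>V\<close>), which is why only directions \<open>v \<in> V\<close> occur.
\<close>

primrec Ck_on :: "'e::euclidean_space set \<Rightarrow> nat \<Rightarrow> 'e set \<Rightarrow> ('e \<Rightarrow> 'b::real_normed_vector) \<Rightarrow> bool"
  where
    "Ck_on V 0 W f \<longleftrightarrow> continuous_on W f"
  | "Ck_on V (Suc k) W f \<longleftrightarrow>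
       (\<exists>f'. (\<forall>x\<in>W. (f has_derivative f' x) (at x within W)) \<and>
             (\<forall>v\<in>V. Ck_on V k W (\<lambda>x. f' x v)))"

definition Cinf_on :: "'e::euclidean_space set \<Rightarrow> 'e set \<Rightarrow> ('e \<Rightarrow> 'b::real_normed_vector) \<Rightarrow> bool"
  where "Cinf_on V W f \<longleftrightarrow> (\<forall>k. Ck_on V k W f)"


section \<open>Smooth manifolds\<close>

text \<open>
  A manifold is given by its topology, its model space and a (not necessarily maximal) smooth
  atlas. A chart \<open>(U, \<phi>)\<close> consists of its domain \<open>U\<close> and a function \<open>\<phi>\<close> of which only the values
  on \<open>U\<close> matter; its inverse is \<open>inv_into U \<phi>\<close>.
\<close>

record ('a, 'e) manifold =
  mfd_top :: "'a topology"
  model_space :: "'e set"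
  atlas :: "('a set \<times> ('a \<Rightarrow> 'e)) set"

abbreviation points :: "('a, 'e) manifold \<Rightarrow> 'a set"
  where "points M \<equiv> topspace (mfd_top M)"

definition chart :: "('a, 'e::euclidean_space) manifold \<Rightarrow> 'a set \<Rightarrow> ('a \<Rightarrow> 'e) \<Rightarrow> bool"
  where "chart M U \<phi> \<longleftrightarrow>
    openin (mfd_top M) U \<and>
    openin (top_of_set (model_space M)) (\<phi> ` U) \<and>
    homeomorphic_map (subtopology (mfd_top M) U) (top_of_set (\<phi> ` U)) \<phi>"

definition smooth_manifold :: "('a, 'e::euclidean_space) manifold \<Rightarrow> bool"
  where "smooth_manifold M \<longleftrightarrow>
    subspace (model_space M) \<and>
    Hausdorff_space (mfd_top M) \<and> second_countable (mfd_top M) \<and>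
    (\<forall>(U, \<phi>) \<in> atlas M. chart M U \<phi>) \<and>
    (\<Union>(U, \<phi>) \<in> atlas M. U) = points M \<and>
    (\<forall>(U, \<phi>) \<in> atlas M. \<forall>(W, \<psi>) \<in> atlas M.
       Cinf_on (model_space M) (\<phi> ` (U \<inter> W)) (\<psi> \<circ> inv_into U \<phi>))"


section \<open>Rings of smooth functions and of germs\<close>

definition smooth_function ::
    "('a, 'e::euclidean_space) manifold \<Rightarrow> 'a set \<Rightarrow> ('a \<Rightarrow> real) \<Rightarrow> bool"
  where "smooth_function M U f \<longleftrightarrow>
    (\<forall>(W, \<phi>) \<in> atlas M. Cinf_on (model_space M) (\<phi> ` (W \<inter> U)) (f \<circ> inv_into W \<phi>))"

text \<open>
  The ring \<open>\<E>(U)\<close> of smooth functions on an open set \<open>U\<close>. A function on \<open>U\<close> is represented by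
  its extension with value \<open>undefined\<close> outside \<open>U\<close>.
\<close>

definition smooth_ring :: "('a, 'e::euclidean_space) manifold \<Rightarrow> 'a set \<Rightarrow> ('a \<Rightarrow> real) ring"
  where "smooth_ring M U =
    \<lparr>carrier = {f \<in> extensional U. smooth_function M U f},
     mult = (\<lambda>f g. \<lambda>x\<in>U. f x * g x),
     one = (\<lambda>x\<in>U. 1),
     zero = (\<lambda>x\<in>U. 0),
     add = (\<lambda>f g. \<lambda>x\<in>U. f x + g x)\<rparr>"

abbreviation smooth_algebra :: "('a, 'e::euclidean_space) manifold \<Rightarrow> ('a \<Rightarrow> real) ring" (\<open>\<E>\<close>)
  where "\<E> M \<equiv> smooth_ring M (points M)"

text \<open>
  A local smooth function at \<open>x\<close> is a pair \<open>(U, f)\<close> with \<open>U\<close> an open neighbourhood of \<open>x\<close> and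
  \<open>f \<in> \<E>(U)\<close>. Its germ is its class with respect to equality near \<open>x\<close>.
\<close>

definition local_functions ::
    "('a, 'e::euclidean_space) manifold \<Rightarrow> 'a \<Rightarrow> ('a set \<times> ('a \<Rightarrow> real)) set"
  where "local_functions M x =
    {(U, f). openin (mfd_top M) U \<and> x \<in> U \<and> f \<in> carrier (smooth_ring M U)}"

definition germ ::
    "('a, 'e::euclidean_space) manifold \<Rightarrow> 'a \<Rightarrow> 'a set \<Rightarrow> ('a \<Rightarrow> real) \<Rightarrow> ('a set \<times> ('a \<Rightarrow> real)) set"
  where "germ M x U f =
    {(W, h) \<in> local_functions M x.
       \<exists>N. openin (mfd_top M) N \<and> x \<in> N \<and> N \<subseteq> U \<inter> W \<and> (\<forall>y\<in>N. f y = h y)}"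

text \<open>
  Sums and products of germs are formed on representatives; all representatives contribute the
  same class, so each union below is a single class.
\<close>

definition germ_ring ::
    "('a, 'e::euclidean_space) manifold \<Rightarrow> 'a \<Rightarrow> ('a set \<times> ('a \<Rightarrow> real)) set ring"
  where "germ_ring M x =
    \<lparr>carrier = (\<lambda>(U, f). germ M x U f) ` local_functions M x,
     mult = (\<lambda>A B. \<Union>(U, f)\<in>A. \<Union>(W, h)\<in>B. germ M x (U \<inter> W) (\<lambda>y\<in>U \<inter> W. f y * h y)),
     one = germ M x (points M) (\<lambda>y\<in>points M. 1),
     zero = germ M x (points M) (\<lambda>y\<in>points M. 0),
     add = (\<lambda>A B. \<Union>(U, f)\<in>A. \<Union>(W, h)\<in>B. germ M x (U \<inter> W) (\<lambda>y\<in>U \<inter> W. f y + h y))\<rparr>"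


section \<open>Saturation, Lojasiewicz radical, zero sets\<close>

definition saturation ::
    "('a, 'e::euclidean_space) manifold \<Rightarrow> ('a \<Rightarrow> real) set \<Rightarrow> ('a \<Rightarrow> real) set"
  where "saturation M \<bb> =
    {g \<in> carrier (\<E> M). \<forall>x\<in>points M.
       germ M x (points M) g \<in> Idl\<^bsub>germ_ring M x\<^esub> (germ M x (points M) ` \<bb>)}"

definition saturated :: "('a, 'e::euclidean_space) manifold \<Rightarrow> ('a \<Rightarrow> real) set \<Rightarrow> bool"
  where "saturated M \<bb> \<longleftrightarrow> \<bb> = saturation M \<bb>"

definition Lojasiewicz_radical ::
    "('a, 'e::euclidean_space) manifold \<Rightarrow> ('a \<Rightarrow> real) set \<Rightarrow> ('a \<Rightarrow> real) set"
  where "Lojasiewicz_radical M \<bb> =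
    {g \<in> carrier (\<E> M). \<exists>f\<in>\<bb>. \<exists>m::nat. m \<ge> 1 \<and> (\<forall>x\<in>points M. f x - g x ^ (2 * m) \<ge> 0)}"

definition zero_set ::
    "('a, 'e::euclidean_space) manifold \<Rightarrow> ('a \<Rightarrow> real) set \<Rightarrow> 'a set"
  where "zero_set M \<aa> = {x \<in> points M. \<forall>f\<in>\<aa>. f x = 0}"

definition vanishing_ideal ::
    "('a, 'e::euclidean_space) manifold \<Rightarrow> 'a set \<Rightarrow> ('a \<Rightarrow> real) set"
  where "vanishing_ideal M X = {g \<in> carrier (\<E> M). \<forall>x\<in>X. g x = 0}"


section \<open>Distances and weakly Lojasiewicz ideals\<close>

definition manifold_distance ::
    "('a, 'e::euclidean_space) manifold \<Rightarrow> ('a \<Rightarrow> 'a \<Rightarrow> real) \<Rightarrow> bool"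
  where "manifold_distance M d \<longleftrightarrow>
    Metric_space (points M) d \<and>
    Metric_space.mtopology (points M) d = mfd_top M \<and>
    (\<forall>(U, \<phi>) \<in> atlas M. \<forall>x\<in>U. \<exists>N. openin (mfd_top M) N \<and> x \<in> N \<and> N \<subseteq> U \<and>
       (\<exists>A>0. \<exists>B>0. \<forall>y\<in>N. \<forall>z\<in>N.
          A * dist (\<phi> y) (\<phi> z) \<le> d y z \<and> d y z \<le> B * dist (\<phi> y) (\<phi> z)))"

definition set_distance :: "('a \<Rightarrow> 'a \<Rightarrow> real) \<Rightarrow> 'a \<Rightarrow> 'a set \<Rightarrow> real"
  where "set_distance d x X = (if X = {} then 1 else (INF y\<in>X. d x y))"

definition locally_finitely_generated ::
    "('a, 'e::euclidean_space) manifold \<Rightarrow> ('a \<Rightarrow> real) set \<Rightarrow> bool"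
  where "locally_finitely_generated M \<aa> \<longleftrightarrow>
    (\<forall>x\<in>points M. \<exists>U F. openin (mfd_top M) U \<and> x \<in> U \<and> finite F \<and> F \<subseteq> \<aa> \<and>
       Idl\<^bsub>smooth_ring M U\<^esub> ((\<lambda>f. restrict f U) ` F) =
       Idl\<^bsub>smooth_ring M U\<^esub> ((\<lambda>f. restrict f U) ` \<aa>))"

definition weakly_Lojasiewicz ::
    "('a, 'e::euclidean_space) manifold \<Rightarrow> ('a \<Rightarrow> 'a \<Rightarrow> real) \<Rightarrow> ('a \<Rightarrow> real) set \<Rightarrow> bool"
  where "weakly_Lojasiewicz M d \<aa> \<longleftrightarrow>
    ideal \<aa> (\<E> M) \<and>
    locally_finitely_generated M \<aa> \<and>
    (\<exists>f\<in>saturation M \<aa>. \<forall>K. compactin (mfd_top M) K \<longrightarrow>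
       (\<exists>c>0. \<exists>m::nat. m \<ge> 1 \<and>
          (\<forall>x\<in>K. \<bar>f x\<bar> \<ge> c * set_distance d x (zero_set M \<aa>) ^ m)))"

end

theory Submission
  imports Defs
begin

text \<open>
  Both cases of the theorem are instances of one equality: the ideal of the zero set \<open>Z\<close> of \<open>\<aa>\<close> is
  the saturation of the Lojasiewicz radical of the saturation of \<open>\<aa>\<close>. If \<open>\<aa>\<close> is saturated, the
  inner saturation is \<open>\<aa>\<close> itself.

  A function in the right-hand side vanishes on \<open>Z\<close>, because passing to the saturation or to the
  radical creates no function that is nonzero at a common zero \<open>x\<close>. For the radical this follows
  from \<open>0 \<le> g\<^sup>2\<^sup>m \<le> f\<close> and \<open>f x = 0\<close>. For the saturation it holds because the germs vanishing at
  \<open>x\<close> form an ideal of the ring of germs (\<open>ideal_vanishing_germs\<close>), which contains every ideal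
  generated by such germs (\<open>saturation_vanishes\<close>).

  Conversely let \<open>g\<close> vanish on \<open>Z\<close> and let \<open>x\<close> be a point. A smooth function is locally Lipschitz, so
  near \<open>x\<close> its absolute value is at most a constant times the distance to its zeros in \<open>Z\<close>
  (\<open>vanishing_bounded_by_distance\<close>). The Lojasiewicz inequality bounds a power of this distance by
  \<open>\<bar>f\<bar>\<close> on compact sets, where \<open>f\<close> lies in the saturation of \<open>\<aa>\<close>. Together these give
  \<open>g\<^sup>2\<^sup>m \<le> const \<cdot> f\<^sup>2\<close> near \<open>x\<close>. Multiplying \<open>g\<close> by a cutoff function (\<open>smooth_cutoff\<close>) turns this into
  an inequality on the whole manifold without changing the germ at \<open>x\<close>, so that the product lies in
  the radical (\<open>vanishing_in_saturated_radical\<close>). As \<open>x\<close> was arbitrary, \<open>g\<close> lies in its saturation.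
  The exponent and the constants depend on \<open>x\<close>, which is why the radical alone may be too
  small and its saturation appears.

  The cutoff function rests on the smoothness of \<open>exp (-1/t)\<close>, extended by zero to \<open>t \<le> 0\<close>
  (\<open>Ck_on_flat\<close>). That it is smooth on the manifold, where it is pieced together from two open
  sets, uses that being \<open>C\<^sup>k\<close> is a local property (\<open>Ck_on_local\<close>).
\<close>

section \<open>Calculus of functions of class \<open>C\<^sup>k\<close>\<close>

lemma Ck_on_SucD: "Ck_on V (Suc k) W f \<Longrightarrow> Ck_on V k W f"
proof (induction k arbitrary: f)
  case 0
  then obtain f' where "\<forall>x\<in>W. (f has_derivative f' x) (at x within W)"
    by auto
  then show ?case
    by (auto simp: continuous_on_eq_continuous_within intro: has_derivative_continuous)
next
  case (Suc k)
  from Suc.prems obtain f' where "\<forall>x\<in>W. (f has_derivative f' x) (at x within W)"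
    and "\<forall>v\<in>V. Ck_on V (Suc k) W (\<lambda>x. f' x v)"
    unfolding Ck_on.simps(2)[of V "Suc k" W f] by blast
  with Suc.IH show ?case
    unfolding Ck_on.simps(2)[of V k W f] by blast
qed

lemma Ck_on_subset: "Ck_on V k W f \<Longrightarrow> W' \<subseteq> W \<Longrightarrow> Ck_on V k W' f"
proof (induction k arbitrary: f)
  case 0
  then show ?case by (auto intro: continuous_on_subset)
next
  case (Suc k)
  from Suc.prems obtain f' where "\<forall>x\<in>W. (f has_derivative f' x) (at x within W)"
    and "\<forall>v\<in>V. Ck_on V k W (\<lambda>x. f' x v)" by auto
  moreover from this(1) have "\<forall>x\<in>W'. (f has_derivative f' x) (at x within W')"
    using has_derivative_subset[OF _ \<open>W' \<subseteq> W\<close>] \<open>W' \<subseteq> W\<close> by blast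
  ultimately show ?case
    using Suc.IH \<open>W' \<subseteq> W\<close> by auto
qed

lemma Ck_on_cong:
  assumes "\<And>x. x \<in> W \<Longrightarrow> f x = g x"
  shows "Ck_on V k W f \<longleftrightarrow> Ck_on V k W g"
proof (cases k)
  case 0
  with assms show ?thesis by (simp cong: continuous_on_cong)
next
  case (Suc l)
  have "(f has_derivative D) (at x within W) \<longleftrightarrow> (g has_derivative D) (at x within W)"
    if "x \<in> W" for x D
    using has_derivative_transform[of x W g f D] has_derivative_transform[of x W f g D] assms that
    by auto
  with Suc show ?thesis by (simp cong: ball_cong)
qed

lemma Ck_on_const: "Ck_on V k W (\<lambda>x. c)"
proof (induction k arbitrary: c)
  case (Suc k)
  then show ?case
    by (auto intro!: exI[of _ "\<lambda>x v. 0"])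
qed simp

lemma Ck_on_id: "Ck_on V k W (\<lambda>x. x)"
proof (cases k)
  case (Suc l)
  then show ?thesis
    by (auto intro!: exI[of _ "\<lambda>x v. v"] Ck_on_const)
qed simp

lemma Ck_on_add: "Ck_on V k W f \<Longrightarrow> Ck_on V k W g \<Longrightarrow> Ck_on V k W (\<lambda>x. f x + g x)"
proof (induction k arbitrary: f g)
  case 0
  then show ?case by (auto intro: continuous_on_add)
next
  case (Suc k)
  obtain f' where "\<forall>x\<in>W. (f has_derivative f' x) (at x within W)"
    and "\<forall>v\<in>V. Ck_on V k W (\<lambda>x. f' x v)" using Suc.prems by auto
  moreover obtain g' where "\<forall>x\<in>W. (g has_derivative g' x) (at x within W)"
    and "\<forall>v\<in>V. Ck_on V k W (\<lambda>x. g' x v)" using Suc.prems by auto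
  ultimately show ?case
    using Suc.IH by (auto intro!: exI[of _ "\<lambda>x v. f' x v + g' x v"] has_derivative_add)
qed

lemma Ck_on_sum:
  "(\<And>i. i \<in> I \<Longrightarrow> Ck_on V k W (f i)) \<Longrightarrow> Ck_on V k W (\<lambda>x. \<Sum>i\<in>I. f i x)"
  by (induction I rule: infinite_finite_induct) (simp_all add: Ck_on_add Ck_on_const)

lemma Ck_on_bilinear:
  assumes "bounded_bilinear B"
  shows "Ck_on V k W f \<Longrightarrow> Ck_on V k W g \<Longrightarrow> Ck_on V k W (\<lambda>x. B (f x) (g x))"
proof (induction k arbitrary: f g)
  case 0
  then show ?case by (auto intro: bounded_bilinear.continuous_on[OF assms])
next
  case (Suc k)
  obtain f' where "\<forall>x\<in>W. (f has_derivative f' x) (at x within W)"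
    and "\<forall>v\<in>V. Ck_on V k W (\<lambda>x. f' x v)" using Suc.prems by auto
  moreover obtain g' where "\<forall>x\<in>W. (g has_derivative g' x) (at x within W)"
    and "\<forall>v\<in>V. Ck_on V k W (\<lambda>x. g' x v)" using Suc.prems by auto
  moreover have "Ck_on V k W f" "Ck_on V k W g"
    using Suc.prems by (blast intro: Ck_on_SucD)+
  ultimately show ?case
    using Suc.IH
    by (auto intro!: exI[of _ "\<lambda>x v. B (f x) (g' x v) + B (f' x v) (g x)"] Ck_on_add
        bounded_bilinear.FDERIV[OF assms])
qed

lemmas Ck_on_mult = Ck_on_bilinear[OF bounded_bilinear_mult]
lemmas Ck_on_scaleR = Ck_on_bilinear[OF bounded_bilinear_scaleR]
lemmas Ck_on_inner = Ck_on_bilinear[OF bounded_bilinear_inner]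

lemma Ck_on_inverse:
  fixes f :: "'e::euclidean_space \<Rightarrow> real"
  assumes nz: "\<And>x. x \<in> W \<Longrightarrow> f x \<noteq> 0"
  shows "Ck_on V k W f \<Longrightarrow> Ck_on V k W (\<lambda>x. inverse (f x))"
proof (induction k)
  case 0
  with nz show ?case by (auto intro!: continuous_on_inverse)
next
  case (Suc k)
  obtain f' where f': "\<forall>x\<in>W. (f has_derivative f' x) (at x within W)"
      "\<forall>v\<in>V. Ck_on V k W (\<lambda>x. f' x v)" using Suc.prems by auto
  have inv: "Ck_on V k W (\<lambda>x. inverse (f x))"
    using Suc Ck_on_SucD by blast
  have "Ck_on V k W (\<lambda>x. (-1) * ((inverse (f x) * f' x v) * inverse (f x)))" if "v \<in> V" for v
    using f' inv that by (intro Ck_on_mult Ck_on_const) auto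
  then have "Ck_on V k W (\<lambda>x. - (inverse (f x) * f' x v * inverse (f x)))" if "v \<in> V" for v
    using that by simp
  with f' nz show ?case
    by (auto intro!: exI[of _ "\<lambda>x v. - (inverse (f x) * f' x v * inverse (f x))"]
        has_derivative_inverse simp del: mult_minus_left mult_minus_right)
qed

text \<open>
  The derivative of \<open>g \<circ> f\<close> in direction \<open>v\<close> is \<open>g' (f x) (f' x v)\<close>, where \<open>x\<close> occurs both in the
  base point and in the direction of \<open>g'\<close>, whereas \<open>Ck_on\<close> only speaks of fixed directions.
  Expanding \<open>f' x v\<close> in an orthonormal basis separates the two dependencies and leaves a sum of
  products of \<open>C\<^sup>k\<close> functions.
\<close>

lemma Ck_on_compose:
  fixes f :: "'e::euclidean_space \<Rightarrow> 'f::euclidean_space"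
    and g :: "'f \<Rightarrow> 'b::real_normed_vector"
  assumes im: "f ` W \<subseteq> W'"
  shows "Ck_on V k W f \<Longrightarrow> Ck_on UNIV k W' g \<Longrightarrow> Ck_on V k W (\<lambda>x. g (f x))"
proof (induction k arbitrary: g)
  case 0
  with im show ?case by (auto intro: continuous_on_compose2)
next
  case (Suc k)
  obtain f' where f': "\<forall>x\<in>W. (f has_derivative f' x) (at x within W)"
    "\<forall>v\<in>V. Ck_on V k W (\<lambda>x. f' x v)" using Suc.prems by auto
  obtain g' where g': "\<forall>y\<in>W'. (g has_derivative g' y) (at y within W')"
    "\<forall>w. Ck_on UNIV k W' (\<lambda>y. g' y w)" using Suc.prems by auto
  have D: "((\<lambda>x. g (f x)) has_derivative (\<lambda>v. g' (f x) (f' x v))) (at x within W)"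
    if "x \<in> W" for x
  proof -
    have "f x \<in> W'" using im that by blast
    with g'(1) have Dg: "(g has_derivative g' (f x)) (at (f x) within f ` W)"
      using has_derivative_subset[OF _ im] by blast
    have "(f has_derivative f' x) (at x within W)" using f'(1) that by blast
    then show ?thesis using Dg by (rule has_derivative_in_compose)
  qed
  have "Ck_on V k W (\<lambda>x. g' (f x) (f' x v))" if v: "v \<in> V" for v
  proof -
    have eq: "g' (f x) (f' x v) = (\<Sum>b\<in>Basis. (f' x v \<bullet> b) *\<^sub>R g' (f x) b)" if "x \<in> W" for x
    proof -
      have "linear (g' (f x))"
        using g'(1) im that has_derivative_linear by blast
      then have "g' (f x) (\<Sum>b\<in>Basis. (f' x v \<bullet> b) *\<^sub>R b) =
          (\<Sum>b\<in>Basis. (f' x v \<bullet> b) *\<^sub>R g' (f x) b)"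
        by (simp add: linear_sum linear_cmul)
      then show ?thesis by (simp add: euclidean_representation)
    qed
    have "Ck_on V k W (\<lambda>x. \<Sum>b\<in>Basis. (f' x v \<bullet> b) *\<^sub>R g' (f x) b)"
      using f'(2) g'(2) v
      by (intro Ck_on_sum Ck_on_scaleR Ck_on_inner Ck_on_const Suc.IH Ck_on_SucD[OF Suc.prems(1)]) auto
    with eq show ?thesis
      by (subst Ck_on_cong) auto
  qed
  with D show ?case
    by (auto intro!: exI[of _ "\<lambda>x v. g' (f x) (f' x v)"])
qed

text \<open>
  A derivative within a set that is open only relative to \<open>V\<close> is not unique as a linear map on the
  whole space. Its value in a direction \<open>v \<in> V\<close> is, being the derivative along the line
  through \<open>x\<close> in direction \<open>v\<close>, which stays in \<open>W\<close> for small parameters.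
\<close>

lemma has_derivative_unique_on_subspace:
  fixes f :: "'e::euclidean_space \<Rightarrow> 'b::real_normed_vector"
  assumes V: "subspace V" and W: "openin (top_of_set V) W" and x: "x \<in> W" and v: "v \<in> V"
    and D: "(f has_derivative D) (at x within W)" and D': "(f has_derivative D') (at x within W)"
  shows "D v = D' v"
proof -
  obtain T where T: "open T" "W = V \<inter> T"
    using W by (auto simp: openin_open)
  define S where "S = (\<lambda>t::real. x + t *\<^sub>R v) -` T"
  have S: "open S"
    unfolding S_def by (intro continuous_open_vimage T continuous_intros)
  have "0 \<in> S" using x T by (simp add: S_def)
  have sub: "(\<lambda>t. x + t *\<^sub>R v) ` S \<subseteq> W"
    using x v V T by (auto simp: S_def intro: subspace_add subspace_scale)
  have "((\<lambda>t. f (x + t *\<^sub>R v)) has_derivative (\<lambda>t. E (t *\<^sub>R v))) (at 0)"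
    if E: "(f has_derivative E) (at x within W)" for E
  proof -
    have "((\<lambda>t. x + t *\<^sub>R v) has_derivative (\<lambda>t. t *\<^sub>R v)) (at 0 within S)"
      by (auto intro!: derivative_eq_intros)
    moreover have "(f has_derivative E) (at (x + 0 *\<^sub>R v) within (\<lambda>t. x + t *\<^sub>R v) ` S)"
      using has_derivative_subset[OF E sub] by simp
    ultimately have "((\<lambda>t. f (x + t *\<^sub>R v)) has_derivative (\<lambda>t. E (t *\<^sub>R v))) (at 0 within S)"
      by (rule has_derivative_in_compose)
    then show ?thesis
      by (simp only: at_within_open[OF \<open>0 \<in> S\<close> S])
  qed
  from has_derivative_unique[OF this[OF D] this[OF D']]
  have "D (1 *\<^sub>R v) = D' (1 *\<^sub>R v)" by metis
  then show ?thesis by simp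
qed

text \<open>
  The derivatives chosen on the different members of the cover may disagree off \<open>V\<close>. Choosing at
  each point the derivative that belongs to its own member still gives \<open>C\<^sup>k\<close> partial derivatives in
  the directions of \<open>V\<close>, because in these directions all choices agree.
\<close>

lemma Ck_on_local:
  fixes f :: "'e::euclidean_space \<Rightarrow> 'b::real_normed_vector"
  assumes V: "subspace V" and W: "openin (top_of_set V) W"
  shows "(\<And>x. x \<in> W \<Longrightarrow> \<exists>T. open T \<and> x \<in> T \<and> Ck_on V k (W \<inter> T) f) \<Longrightarrow> Ck_on V k W f"
proof (induction k arbitrary: f)
  case 0
  have "continuous (at x within W) f" if x: "x \<in> W" for x
  proof -
    obtain T where "open T" "x \<in> T" "continuous_on (W \<inter> T) f"
      using 0 x by auto
    then have "continuous (at x within W \<inter> T) f"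
      using x by (simp add: continuous_on_eq_continuous_within)
    moreover have "at x within W \<inter> T = at x within W"
      using \<open>open T\<close> \<open>x \<in> T\<close> by (intro at_within_nhd[where S = T]) auto
    ultimately show ?thesis by simp
  qed
  then show ?case by (simp add: continuous_on_eq_continuous_within)
next
  case (Suc k)
  then obtain T where T: "\<And>x. x \<in> W \<Longrightarrow> open (T x) \<and> x \<in> T x \<and> Ck_on V (Suc k) (W \<inter> T x) f"
    by metis
  then have "\<forall>x\<in>W. \<exists>D. (\<forall>y\<in>W \<inter> T x. (f has_derivative D y) (at y within W \<inter> T x)) \<and>
      (\<forall>v\<in>V. Ck_on V k (W \<inter> T x) (\<lambda>y. D y v))"
    by auto
  then obtain D where D0: "\<And>x y. x \<in> W \<Longrightarrow> y \<in> W \<inter> T x \<Longrightarrow>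
        (f has_derivative D x y) (at y within W \<inter> T x)"
      and Dk: "\<And>x v. x \<in> W \<Longrightarrow> v \<in> V \<Longrightarrow> Ck_on V k (W \<inter> T x) (\<lambda>y. D x y v)"
    unfolding Ball_def by metis
  have D: "(f has_derivative D x y) (at y within W)" if "x \<in> W" "y \<in> W \<inter> T x" for x y
  proof -
    have "at y within W \<inter> T x = at y within W"
      using T[OF that(1)] that(2) by (intro at_within_nhd[where S = "T x"]) auto
    with D0[OF that] show ?thesis by simp
  qed
  have "Ck_on V k W (\<lambda>x. D x x v)" if v: "v \<in> V" for v
  proof (rule Suc.IH)
    fix x assume x: "x \<in> W"
    have "D y y v = D x y v" if "y \<in> W \<inter> T x" for y
      using has_derivative_unique_on_subspace[OF V W _ v] D T x that by blast
    with Dk[OF x v] have "Ck_on V k (W \<inter> T x) (\<lambda>x. D x x v)"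
      by (subst Ck_on_cong) auto
    with T x show "\<exists>T. open T \<and> x \<in> T \<and> Ck_on V k (W \<inter> T) (\<lambda>x. D x x v)" by blast
  qed
  moreover have "(f has_derivative D x x) (at x within W)" if "x \<in> W" for x
    using D T that by auto
  ultimately show ?case by (auto intro!: exI[of _ "\<lambda>x. D x x"])
qed

text \<open>
  This is the mean value inequality. Continuity and compactness bound the derivative in the
  directions of \<open>V\<close> only; outside \<open>V\<close> nothing is known about \<open>f' x\<close>. Precomposing \<open>f' x\<close> with the
  orthogonal projection onto \<open>V\<close> keeps it a derivative within \<open>K \<subseteq> V\<close> and makes its operator norm
  bounded.
\<close>

lemma Ck_on_bounded_Lipschitz:
  fixes f :: "'e::euclidean_space \<Rightarrow> real"
  assumes V: "subspace V" and K: "compact K" "convex K" "K \<subseteq> V" and f: "Ck_on V 1 K f"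
  obtains L where "L > 0"
    "\<And>y z. y \<in> K \<Longrightarrow> z \<in> K \<Longrightarrow> \<bar>f y - f z\<bar> \<le> L * dist y z" "\<And>y. y \<in> K \<Longrightarrow> \<bar>f y\<bar> \<le> L"
proof -
  obtain f' where f': "\<And>x. x \<in> K \<Longrightarrow> (f has_derivative f' x) (at x within K)"
    and f'c: "\<And>v. v \<in> V \<Longrightarrow> continuous_on K (\<lambda>x. f' x v)"
    using f by auto
  obtain B where B: "B \<subseteq> V" "pairwise orthogonal B" "\<And>b. b \<in> B \<Longrightarrow> norm b = 1"
    "independent B" "span B = V"
    using orthonormal_basis_subspace[OF V] by metis
  have "finite B" using B(4) by (rule independent_imp_finite)
  define P where "P v = (\<Sum>b\<in>B. (v \<bullet> b) *\<^sub>R b)" for v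
  have P: "P v = v" if "v \<in> V" for v
    unfolding P_def using B \<open>finite B\<close> that by (intro orthonormal_basis_expand) auto
  have linP: "bounded_linear P"
    unfolding P_def by (intro bounded_linear_sum bounded_linear_compose[OF bounded_linear_scaleR_left]
        bounded_linear_inner_left)
  have "\<exists>c. \<forall>x\<in>K. \<bar>f' x b\<bar> \<le> c" if "b \<in> B" for b
    using compact_imp_bounded[OF compact_continuous_image[OF f'c K(1)]] that B(1)
    by (auto simp: bounded_iff)
  then obtain c where c: "\<And>b x. b \<in> B \<Longrightarrow> x \<in> K \<Longrightarrow> \<bar>f' x b\<bar> \<le> c b" by metis
  have onorm: "onorm (f' x \<circ> P) \<le> (\<Sum>b\<in>B. \<bar>c b\<bar>)" if x: "x \<in> K" for x
  proof (rule onorm_bound)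
    fix v
    have lin: "linear (f' x)" using f'[OF x] by (rule has_derivative_linear)
    have "norm ((f' x \<circ> P) v) = \<bar>\<Sum>b\<in>B. (v \<bullet> b) * f' x b\<bar>"
      unfolding P_def o_def using lin by (simp add: linear_sum linear_cmul)
    also have "\<dots> \<le> (\<Sum>b\<in>B. \<bar>(v \<bullet> b) * f' x b\<bar>)" by (rule sum_abs)
    also have "\<dots> \<le> (\<Sum>b\<in>B. norm v * \<bar>c b\<bar>)"
    proof (rule sum_mono)
      fix b assume b: "b \<in> B"
      have "\<bar>v \<bullet> b\<bar> \<le> norm v"
        using Cauchy_Schwarz_ineq2[of v b] B(3)[OF b] by simp
      then show "\<bar>(v \<bullet> b) * f' x b\<bar> \<le> norm v * \<bar>c b\<bar>"
        using c[OF b x] unfolding abs_mult by (intro mult_mono) auto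
    qed
    finally show "norm ((f' x \<circ> P) v) \<le> (\<Sum>b\<in>B. \<bar>c b\<bar>) * norm v"
      by (simp add: sum_distrib_left mult.commute)
  qed (simp add: sum_nonneg)
  have derP: "(f has_derivative f' x \<circ> P) (at x within K)" if x: "x \<in> K" for x
  proof -
    have "P (y - x) = y - x" if "y \<in> K" for y
      using P K(3) V x that by (meson subsetD subspace_diff)
    then have "((\<lambda>y. (1 / norm (y - x)) *\<^sub>R (f y - (f x + (f' x \<circ> P) (y - x)))) \<longlongrightarrow> 0) (at x within K)
        \<longleftrightarrow> ((\<lambda>y. (1 / norm (y - x)) *\<^sub>R (f y - (f x + f' x (y - x)))) \<longlongrightarrow> 0) (at x within K)"
      by (intro filterlim_cong) (auto simp: eventually_at_topological)
    moreover have "bounded_linear (f' x \<circ> P)"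
      using bounded_linear_compose[OF has_derivative_bounded_linear[OF f'[OF x]] linP]
      by (simp add: o_def)
    ultimately show ?thesis
      using f'[OF x] unfolding has_derivative_within by blast
  qed
  have Lip: "\<bar>f y - f z\<bar> \<le> (\<Sum>b\<in>B. \<bar>c b\<bar>) * dist y z" if "y \<in> K" "z \<in> K" for y z
    using differentiable_bound[OF K(2) derP onorm] that by (simp add: dist_norm)
  have "continuous_on K f" using f Ck_on_SucD[of V 0] by fastforce
  then have "bounded (f ` K)"
    by (intro compact_imp_bounded compact_continuous_image K)
  then obtain c0 where c0: "\<And>y. y \<in> K \<Longrightarrow> \<bar>f y\<bar> \<le> c0"
    by (auto simp: bounded_real)
  define L where "L = (\<Sum>b\<in>B. \<bar>c b\<bar>) + \<bar>c0\<bar> + 1"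
  have s: "0 \<le> (\<Sum>b\<in>B. \<bar>c b\<bar>)" by (simp add: sum_nonneg)
  show thesis
  proof
    show "L > 0" using s unfolding L_def by linarith
    show "\<bar>f y - f z\<bar> \<le> L * dist y z" if "y \<in> K" "z \<in> K" for y z
    proof -
      have "(\<Sum>b\<in>B. \<bar>c b\<bar>) * dist y z \<le> L * dist y z"
        by (intro mult_right_mono) (auto simp: L_def)
      with Lip[OF that] show ?thesis by linarith
    qed
    show "\<bar>f y\<bar> \<le> L" if "y \<in> K" for y
      using c0[OF that] s unfolding L_def by linarith
  qed
qed

section \<open>Cutoff functions on Euclidean space\<close>

text \<open>
  For \<open>n = 0\<close> this is the classical flat function \<open>exp (-1/t)\<close>, extended by zero. The extra powers
  of \<open>1/t\<close> make the family closed under differentiation up to linear combinations, so that one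
  induction proves smoothness of all members.
\<close>

definition flat :: "nat \<Rightarrow> real \<Rightarrow> real" where
  "flat n t = (if t \<le> 0 then 0 else exp (- inverse t) * inverse t ^ n)"

lemma flat_DERIV: "(flat n has_real_derivative flat (n + 2) t - n * flat (n + 1) t) (at t)"
proof -
  consider "t > 0" | "t < 0" | "t = 0" by linarith
  then show ?thesis
  proof cases
    case 1
    have E: "((\<lambda>t. exp (- inverse t)) has_real_derivative exp (- inverse t) * inverse t ^ 2) (at t)"
      and I: "(inverse has_real_derivative - (inverse t ^ 2)) (at t)"
      using 1 by (auto intro!: derivative_eq_intros simp: power2_eq_square)
    have "exp (- u) * u ^ 2 * u ^ n + real n * (- (u ^ 2) * u ^ (n - Suc 0)) * exp (- u)
        = exp (- u) * u ^ (n + 2) - n * (exp (- u) * u ^ (n + 1))" for u :: real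
      by (cases n) (simp_all add: power2_eq_square algebra_simps)
    with DERIV_mult[OF E DERIV_power[OF I, of n]] 1
    have D: "((\<lambda>t. exp (- inverse t) * inverse t ^ n) has_real_derivative
        flat (n + 2) t - n * flat (n + 1) t) (at t)"
      by (simp add: flat_def)
    have ev: "\<forall>\<^sub>F s in nhds t. flat n s = exp (- inverse s) * inverse s ^ n"
      using eventually_nhds_in_open[of "{0<..}" t] 1
      by (auto simp: flat_def elim: eventually_mono)
    show ?thesis
      by (rule iffD2[OF DERIV_cong_ev[OF refl ev refl] D])
  next
    case 2
    have D: "((\<lambda>t. 0) has_real_derivative flat (n + 2) t - n * flat (n + 1) t) (at t)"
      using 2 by (simp add: flat_def)
    have ev: "\<forall>\<^sub>F s in nhds t. flat n s = 0"
      using eventually_nhds_in_open[of "{..<0}" t] 2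
      by (auto simp: flat_def elim: eventually_mono)
    show ?thesis
      by (rule iffD2[OF DERIV_cong_ev[OF refl ev refl] D])
  next
    case 3
    \<comment> \<open>At the origin the difference quotient is \<open>s ^ (n + 1) / exp s\<close> with \<open>s = 1/h\<close>.\<close>
    have "((\<lambda>s. s ^ (n + 1) / exp s) \<longlongrightarrow> (0::real)) at_top"
      by (rule tendsto_power_div_exp_0)
    then have "((\<lambda>h. inverse h ^ (n + 1) / exp (inverse h)) \<longlongrightarrow> (0::real)) (at_right 0)"
      by (rule filterlim_compose[OF _ filterlim_inverse_at_top_right])
    then have right: "((\<lambda>h. flat n h / h) \<longlongrightarrow> 0) (at_right 0)"
      by (rule Lim_transform_eventually)
        (auto simp: flat_def exp_minus field_simps eventually_at_filter)
    have left: "((\<lambda>h. flat n h / h) \<longlongrightarrow> 0) (at_left 0)"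
      by (rule Lim_transform_eventually[OF tendsto_const])
        (auto simp: flat_def eventually_at_filter)
    from left right have "((\<lambda>h. flat n h / h) \<longlongrightarrow> 0) (at 0)"
      by (rule filterlim_split_at)
    then have "(flat n has_real_derivative 0) (at 0)"
      by (simp add: DERIV_def flat_def)
    with 3 show ?thesis by (simp add: flat_def)
  qed
qed

lemma Ck_on_flat: "Ck_on UNIV k UNIV (flat n)"
proof (induction k arbitrary: n)
  case 0
  then show ?case
    by (auto simp: continuous_on_eq_continuous_at intro: DERIV_isCont[OF flat_DERIV])
next
  case (Suc k)
  have "Ck_on UNIV k UNIV (\<lambda>t. v * (flat (n + 2) t + (- real n) * flat (n + 1) t))" for v
    by (intro Ck_on_mult Ck_on_add Ck_on_const Suc.IH)
  then have "Ck_on UNIV k UNIV (\<lambda>t. (flat (n + 2) t - n * flat (n + 1) t) * v)" for v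
    by (simp add: mult.commute)
  with flat_DERIV show ?case
    by (auto intro!: exI[of _ "\<lambda>t v. (flat (n + 2) t - n * flat (n + 1) t) * v"]
        simp: has_field_derivative_def)
qed

definition smooth_step :: "real \<Rightarrow> real" where
  "smooth_step t = flat 0 t * inverse (flat 0 t + flat 0 (1 - t))"

lemma smooth_step_denominator_pos: "flat 0 t + flat 0 (1 - t) > 0"
  by (auto simp: flat_def add_pos_pos)

lemma smooth_step_bounds: "0 \<le> smooth_step t" "smooth_step t \<le> 1"
proof -
  have "0 \<le> flat 0 t" "0 \<le> flat 0 (1 - t)" by (auto simp: flat_def)
  then show "0 \<le> smooth_step t" "smooth_step t \<le> 1"
    using smooth_step_denominator_pos[of t]
    by (auto simp: smooth_step_def divide_inverse[symmetric])
qed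

lemma smooth_step_eq_0: "t \<le> 0 \<Longrightarrow> smooth_step t = 0"
  by (simp add: smooth_step_def flat_def)

lemma smooth_step_eq_1: "t \<ge> 1 \<Longrightarrow> smooth_step t = 1"
  by (simp add: smooth_step_def flat_def)

lemma Ck_on_smooth_step: "Ck_on UNIV k UNIV smooth_step"
proof -
  have "Ck_on UNIV k UNIV (\<lambda>t::real. 1 + (-1) * t)"
    by (intro Ck_on_add Ck_on_mult Ck_on_const Ck_on_id)
  then have "Ck_on UNIV k UNIV (\<lambda>t::real. 1 - t)" by simp
  from Ck_on_compose[OF _ this Ck_on_flat]
  have refl: "Ck_on UNIV k UNIV (\<lambda>t. flat 0 (1 - t))" by blast
  have pos: "flat 0 t + flat 0 (1 - t) \<noteq> 0" for t
    using smooth_step_denominator_pos[of t] by simp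
  have "Ck_on UNIV k UNIV (\<lambda>t. flat 0 t * inverse (flat 0 t + flat 0 (1 - t)))"
    by (rule Ck_on_mult[OF Ck_on_flat Ck_on_inverse[OF pos Ck_on_add[OF Ck_on_flat refl]]])
  then show ?thesis by (simp add: smooth_step_def[abs_def])
qed

lemma Euclidean_cutoff:
  fixes p :: "'e::euclidean_space"
  assumes "\<rho> > 0"
  obtains b :: "'e \<Rightarrow> real" and \<delta> where
    "Cinf_on UNIV UNIV b" "\<And>v. 0 \<le> b v \<and> b v \<le> 1" "\<And>v. dist p v \<ge> \<rho> \<Longrightarrow> b v = 0"
    "\<delta> > 0" "\<And>v. dist p v < \<delta> \<Longrightarrow> b v = 1"
proof
  \<comment> \<open>The argument of the step is \<open>2 - 2 |v - p|\<^sup>2 / \<rho>\<^sup>2\<close>: nonpositive outside the ball of radius \<open>\<rho>\<close>,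
      at least 1 on the ball of radius \<open>\<rho>/2\<close>, and a polynomial in \<open>v\<close>.\<close>
  define b where "b v = smooth_step (2 + (- 2 / \<rho>\<^sup>2) * ((v + - p) \<bullet> (v + - p)))" for v
  have b: "b v = smooth_step (2 - 2 * (dist p v / \<rho>)\<^sup>2)" for v
    by (simp add: b_def dist_norm norm_minus_commute power_divide dot_square_norm)
  show "Cinf_on UNIV UNIV b"
    unfolding Cinf_on_def b_def
    by (intro allI Ck_on_compose[OF _ _ Ck_on_smooth_step] Ck_on_add Ck_on_mult Ck_on_inner
        Ck_on_const Ck_on_id) auto
  show "0 \<le> b v \<and> b v \<le> 1" for v
    by (simp add: b_def smooth_step_bounds)
  show "b v = 0" if "dist p v \<ge> \<rho>" for v
  proof -
    have "1 \<le> dist p v / \<rho>" using that assms by simp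
    then have "1 \<le> (dist p v / \<rho>)\<^sup>2" by simp
    then show ?thesis unfolding b by (intro smooth_step_eq_0) simp
  qed
  show "\<rho> / 2 > 0" using assms by simp
  show "b v = 1" if "dist p v < \<rho> / 2" for v
  proof -
    have "0 \<le> dist p v / \<rho>" "dist p v / \<rho> \<le> 1 / 2" using that assms by (auto simp: field_simps)
    then have "(dist p v / \<rho>)\<^sup>2 \<le> (1 / 2)\<^sup>2" by (intro power_mono)
    also have "\<dots> \<le> (1 / 2 :: real)" by (simp add: power2_eq_square)
    finally show ?thesis unfolding b by (intro smooth_step_eq_1) linarith
  qed
qed

section \<open>Smooth functions on a manifold\<close>
lemma smooth_ring_carrier [simp]:
  "f \<in> carrier (smooth_ring M U) \<longleftrightarrow> f \<in> extensional U \<and> smooth_function M U f"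
  by (simp add: smooth_ring_def)

lemma Cinf_on_subset: "Cinf_on V W f \<Longrightarrow> W' \<subseteq> W \<Longrightarrow> Cinf_on V W' f"
  unfolding Cinf_on_def by (blast intro: Ck_on_subset)

lemma Cinf_on_cong: "(\<And>x. x \<in> W \<Longrightarrow> f x = g x) \<Longrightarrow> Cinf_on V W f \<longleftrightarrow> Cinf_on V W g"
  unfolding Cinf_on_def using Ck_on_cong by blast

lemma smooth_function_subset: "smooth_function M U f \<Longrightarrow> U' \<subseteq> U \<Longrightarrow> smooth_function M U' f"
  unfolding smooth_function_def
proof clarify
  fix W \<phi> assume "\<forall>(W, \<phi>)\<in>atlas M. Cinf_on (model_space M) (\<phi> ` (W \<inter> U)) (f \<circ> inv_into W \<phi>)"
    and "U' \<subseteq> U" "(W, \<phi>) \<in> atlas M"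
  then have "Cinf_on (model_space M) (\<phi> ` (W \<inter> U)) (f \<circ> inv_into W \<phi>)" by blast
  then show "Cinf_on (model_space M) (\<phi> ` (W \<inter> U')) (f \<circ> inv_into W \<phi>)"
    by (rule Cinf_on_subset) (use \<open>U' \<subseteq> U\<close> in blast)
qed

lemma smooth_function_const: "smooth_function M U (\<lambda>x. c)"
  by (simp add: smooth_function_def Cinf_on_def o_def Ck_on_const case_prod_beta)

lemma smooth_function_add:
  "smooth_function M U f \<Longrightarrow> smooth_function M U g \<Longrightarrow> smooth_function M U (\<lambda>x. f x + g x)"
  unfolding smooth_function_def Cinf_on_def o_def by (clarify, rule Ck_on_add) blast+

lemma smooth_function_mult:
  "smooth_function M U f \<Longrightarrow> smooth_function M U g \<Longrightarrow> smooth_function M U (\<lambda>x. f x * g x)"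
  unfolding smooth_function_def Cinf_on_def o_def by (clarify, rule Ck_on_mult) blast+

lemma smooth_function_uminus: "smooth_function M U f \<Longrightarrow> smooth_function M U (\<lambda>x. - f x)"
  using smooth_function_mult[OF smooth_function_const[of M U "-1"]] by simp

context
  fixes M :: "('a, 'e::euclidean_space) manifold"
  assumes M: "smooth_manifold M"
begin

lemma subspace_model_space: "subspace (model_space M)"
  using M by (simp add: smooth_manifold_def)

lemma Hausdorff_manifold: "Hausdorff_space (mfd_top M)"
  using M by (simp add: smooth_manifold_def)

lemma point_in_chart:
  assumes "x \<in> points M"
  obtains U \<phi> where "(U, \<phi>) \<in> atlas M" "x \<in> U"
  using M assms unfolding smooth_manifold_def by blast

lemma chartD:
  assumes "(U, \<phi>) \<in> atlas M"
  shows "openin (mfd_top M) U" "openin (top_of_set (model_space M)) (\<phi> ` U)"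
    "homeomorphic_map (subtopology (mfd_top M) U) (top_of_set (\<phi> ` U)) \<phi>"
  using M assms unfolding smooth_manifold_def chart_def by auto

lemma Cinf_on_transition:
  assumes "(U, \<phi>) \<in> atlas M" "(W, \<psi>) \<in> atlas M"
  shows "Cinf_on (model_space M) (\<phi> ` (U \<inter> W)) (\<psi> \<circ> inv_into U \<phi>)"
proof -
  have "\<forall>(U, \<phi>) \<in> atlas M. \<forall>(W, \<psi>) \<in> atlas M.
      Cinf_on (model_space M) (\<phi> ` (U \<inter> W)) (\<psi> \<circ> inv_into U \<phi>)"
    using M unfolding smooth_manifold_def by (elim conjE)
  from bspec[OF this assms(1)] have "\<forall>(W, \<psi>) \<in> atlas M.
      Cinf_on (model_space M) (\<phi> ` (U \<inter> W)) (\<psi> \<circ> inv_into U \<phi>)" by simp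
  from bspec[OF this assms(2)] show ?thesis by simp
qed

lemma chart_topspace: "(U, \<phi>) \<in> atlas M \<Longrightarrow> topspace (subtopology (mfd_top M) U) = U"
  using chartD(1) openin_subset by fastforce

lemma inj_on_chart: "(U, \<phi>) \<in> atlas M \<Longrightarrow> inj_on \<phi> U"
  using chartD(3) chart_topspace homeomorphic_imp_injective_map by fastforce

lemma chart_image_subset: "(U, \<phi>) \<in> atlas M \<Longrightarrow> \<phi> ` U \<subseteq> model_space M"
  using chartD(2) openin_imp_subset by blast

lemma openin_chart_image:
  assumes \<phi>: "(U, \<phi>) \<in> atlas M" and N: "openin (mfd_top M) N"
  shows "openin (top_of_set (model_space M)) (\<phi> ` (U \<inter> N))"
proof -
  have "openin (subtopology (mfd_top M) U) (U \<inter> N)"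
    using N by (rule openin_subtopology_Int2)
  then have "openin (top_of_set (\<phi> ` U)) (\<phi> ` (U \<inter> N))"
    using chartD(3)[OF \<phi>] homeomorphic_imp_open_map open_map_def by blast
  then show ?thesis
    using chartD(2)[OF \<phi>] openin_trans by blast
qed

lemma openin_chart_vimage:
  assumes \<phi>: "(U, \<phi>) \<in> atlas M" and S: "open S"
  shows "openin (mfd_top M) {y \<in> U. \<phi> y \<in> S}"
proof -
  have "openin (top_of_set (\<phi> ` U)) (\<phi> ` U \<inter> S)"
    using S by (rule openin_open_Int)
  then have "openin (subtopology (mfd_top M) U) {y \<in> U. \<phi> y \<in> \<phi> ` U \<inter> S}"
    using homeomorphic_imp_continuous_map[OF chartD(3)[OF \<phi>]] chart_topspace[OF \<phi>]
    by (metis (no_types, lifting) openin_continuous_map_preimage Collect_cong)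
  moreover have "{y \<in> U. \<phi> y \<in> \<phi> ` U \<inter> S} = {y \<in> U. \<phi> y \<in> S}" by auto
  ultimately show ?thesis
    using openin_trans_full[OF _ chartD(1)[OF \<phi>]] by simp
qed

lemma compactin_chart_inverse:
  assumes \<phi>: "(U, \<phi>) \<in> atlas M" and S: "compact S" "S \<subseteq> \<phi> ` U"
  shows "compactin (mfd_top M) (inv_into U \<phi> ` S)"
proof -
  obtain g where g: "homeomorphic_maps (subtopology (mfd_top M) U) (top_of_set (\<phi> ` U)) \<phi> g"
    using chartD(3)[OF \<phi>] homeomorphic_map_maps by blast
  have "inv_into U \<phi> ` S = g ` S"
  proof (rule image_cong[OF refl])
    fix v assume "v \<in> S"
    then obtain y where y: "y \<in> U" "v = \<phi> y" using S by blast
    then have "g v = y"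
      using g chart_topspace[OF \<phi>] by (auto simp: homeomorphic_maps_def)
    then show "inv_into U \<phi> v = g v" using y inj_on_chart[OF \<phi>] by simp
  qed
  moreover have "compactin (top_of_set (\<phi> ` U)) S"
    using S by (simp add: compactin_subtopology)
  then have "compactin (subtopology (mfd_top M) U) (g ` S)"
    using g image_compactin unfolding homeomorphic_maps_def by blast
  ultimately show ?thesis by (simp add: compactin_subtopology)
qed

lemma chart_cball:
  assumes \<phi>: "(U, \<phi>) \<in> atlas M" and N: "openin (mfd_top M) N" and x: "x \<in> U" "x \<in> N"
  obtains \<rho> where "\<rho> > 0" "cball (\<phi> x) \<rho> \<inter> model_space M \<subseteq> \<phi> ` (U \<inter> N)"
  using openin_chart_image[OF \<phi> N] x unfolding openin_contains_cball by blast

lemma smooth_function_cong: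
  assumes "\<And>x. x \<in> U \<Longrightarrow> f x = g x"
  shows "smooth_function M U f \<longleftrightarrow> smooth_function M U g"
proof -
  have "Cinf_on (model_space M) (\<phi> ` (W \<inter> U)) (f \<circ> inv_into W \<phi>) \<longleftrightarrow>
      Cinf_on (model_space M) (\<phi> ` (W \<inter> U)) (g \<circ> inv_into W \<phi>)" if "(W, \<phi>) \<in> atlas M" for W \<phi>
    using assms inj_on_chart[OF that] by (intro Cinf_on_cong) auto
  then show ?thesis unfolding smooth_function_def by blast
qed

text \<open>
  Openness of the pieces matters here: it makes their images open in the model space, and only
  there are derivatives determined well enough to be glued.
\<close>

lemma smooth_function_Un:
  assumes U: "openin (mfd_top M) U1" "openin (mfd_top M) U2"
    and f: "smooth_function M U1 f" "smooth_function M U2 f"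
  shows "smooth_function M (U1 \<union> U2) f"
  unfolding smooth_function_def Cinf_on_def
proof clarify
  fix W \<phi> k assume \<phi>: "(W, \<phi>) \<in> atlas M"
  show "Ck_on (model_space M) k (\<phi> ` (W \<inter> (U1 \<union> U2))) (f \<circ> inv_into W \<phi>)"
  proof (rule Ck_on_local[OF subspace_model_space])
    show "openin (top_of_set (model_space M)) (\<phi> ` (W \<inter> (U1 \<union> U2)))"
      using U \<phi> by (intro openin_chart_image) auto
    fix v assume "v \<in> \<phi> ` (W \<inter> (U1 \<union> U2))"
    then obtain U' where U': "U' = U1 \<or> U' = U2" "v \<in> \<phi> ` (W \<inter> U')" by blast
    then obtain S where S: "open S" "\<phi> ` (W \<inter> U') = model_space M \<inter> S"
      using openin_chart_image[OF \<phi>] U unfolding openin_open by metis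
    have sm: "Ck_on (model_space M) k (\<phi> ` (W \<inter> U')) (f \<circ> inv_into W \<phi>)"
      using f \<phi> U'(1) unfolding smooth_function_def Cinf_on_def by blast
    have "\<phi> ` (W \<inter> (U1 \<union> U2)) \<inter> S \<subseteq> \<phi> ` (W \<inter> U')"
      using S chart_image_subset[OF \<phi>] by auto
    then show "\<exists>S. open S \<and> v \<in> S \<and>
        Ck_on (model_space M) k (\<phi> ` (W \<inter> (U1 \<union> U2)) \<inter> S) (f \<circ> inv_into W \<phi>)"
      using S U'(2) Ck_on_subset[OF sm] by blast
  qed
qed

text \<open>
  A Euclidean cutoff function is transported by a chart \<open>\<phi>\<close> at \<open>x\<close> and extended by zero. The
  extension is smooth because the manifold is covered by the chart domain and the complement of
  \<open>K\<close>, the preimage of a closed ball; this complement is open since compact sets in a Hausdorff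
  space are closed.
\<close>

lemma smooth_cutoff:
  assumes x: "x \<in> points M" and N: "openin (mfd_top M) N" "x \<in> N"
  obtains \<eta> K G where "\<eta> \<in> carrier (\<E> M)"
    "\<And>y. y \<in> points M \<Longrightarrow> 0 \<le> \<eta> y \<and> \<eta> y \<le> 1"
    "compactin (mfd_top M) K" "K \<subseteq> N" "\<And>y. y \<in> points M \<Longrightarrow> y \<notin> K \<Longrightarrow> \<eta> y = 0"
    "openin (mfd_top M) G" "x \<in> G" "\<And>y. y \<in> G \<Longrightarrow> \<eta> y = 1"
proof -
  obtain U \<phi> where \<phi>: "(U, \<phi>) \<in> atlas M" "x \<in> U"
    using x point_in_chart by blast
  obtain \<rho> where \<rho>: "\<rho> > 0" "cball (\<phi> x) \<rho> \<inter> model_space M \<subseteq> \<phi> ` (U \<inter> N)"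
    using chart_cball[OF \<phi>(1) N(1) \<phi>(2) N(2)] by blast
  obtain b \<delta> where b: "Cinf_on UNIV UNIV b" "\<And>v. 0 \<le> b v \<and> b v \<le> (1::real)"
    "\<And>v. dist (\<phi> x) v \<ge> \<rho> \<Longrightarrow> b v = 0" "\<delta> > 0" "\<And>v. dist (\<phi> x) v < \<delta> \<Longrightarrow> b v = 1"
    using Euclidean_cutoff[OF \<rho>(1), of "\<phi> x"] by blast
  define C where "C = cball (\<phi> x) \<rho> \<inter> model_space M"
  define K where "K = inv_into U \<phi> ` C"
  define \<eta> where "\<eta> y = (if y \<in> U then b (\<phi> y) else 0)" for y
  have "compact C"
    unfolding C_def by (intro compact_Int_closed compact_cball closed_subspace subspace_model_space)
  have "C \<subseteq> \<phi> ` U" using \<rho>(2) by (auto simp: C_def)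
  with \<open>compact C\<close> have K: "compactin (mfd_top M) K"
    unfolding K_def using compactin_chart_inverse[OF \<phi>(1)] by blast
  have K_I: "y \<in> K" if "y \<in> U" "\<phi> y \<in> C" for y
  proof -
    have "inv_into U \<phi> (\<phi> y) \<in> K" unfolding K_def using that(2) by (rule imageI)
    then show ?thesis using that(1) inj_on_chart[OF \<phi>(1)] by simp
  qed
  have "K \<subseteq> U \<inter> N"
  proof
    fix y assume "y \<in> K"
    then obtain v where v: "v \<in> C" "y = inv_into U \<phi> v" unfolding K_def by blast
    then obtain z where "z \<in> U \<inter> N" "v = \<phi> z" using \<rho>(2) unfolding C_def by blast
    then show "y \<in> U \<inter> N" using v inj_on_chart[OF \<phi>(1)] by simp
  qed
  have zero: "\<eta> y = 0" if "y \<notin> K" for y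
  proof (cases "y \<in> U")
    case True
    then have "\<phi> y \<notin> cball (\<phi> x) \<rho>"
      using that K_I chart_image_subset[OF \<phi>(1)] by (auto simp: C_def)
    with True b(3) show ?thesis by (simp add: \<eta>_def)
  qed (simp add: \<eta>_def)
  have "smooth_function M U (\<lambda>y. b (\<phi> y))"
    unfolding smooth_function_def Cinf_on_def
  proof clarify
    fix W \<psi> k assume \<psi>: "(W, \<psi>) \<in> atlas M"
    from Cinf_on_transition[OF \<psi> \<phi>(1)] have "Ck_on (model_space M) k (\<psi> ` (W \<inter> U)) (\<phi> \<circ> inv_into W \<psi>)"
      by (simp add: Cinf_on_def)
    moreover have "Ck_on UNIV k UNIV b" using b(1) by (simp add: Cinf_on_def)
    ultimately show "Ck_on (model_space M) k (\<psi> ` (W \<inter> U)) ((\<lambda>y. b (\<phi> y)) \<circ> inv_into W \<psi>)"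
      using Ck_on_compose[of "\<phi> \<circ> inv_into W \<psi>" _ UNIV] by (simp add: o_def)
  qed
  then have 1: "smooth_function M U \<eta>"
    by (subst smooth_function_cong[of _ _ "\<lambda>y. b (\<phi> y)"]) (auto simp: \<eta>_def)
  have 2: "smooth_function M (points M - K) \<eta>"
    using zero by (subst smooth_function_cong[of _ _ "\<lambda>y. 0"]) (auto intro: smooth_function_const)
  have "openin (mfd_top M) (points M - K)"
    using compactin_imp_closedin[OF Hausdorff_manifold K] by blast
  from smooth_function_Un[OF chartD(1)[OF \<phi>(1)] this 1 2]
  have "smooth_function M (points M) \<eta>"
    by (rule smooth_function_subset) (use \<open>K \<subseteq> U \<inter> N\<close> in auto)
  then have "smooth_function M (points M) (restrict \<eta> (points M))"
    by (subst smooth_function_cong[of _ _ \<eta>]) auto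
  moreover define G where "G = {y \<in> U. \<phi> y \<in> ball (\<phi> x) \<delta>}"
  have "openin (mfd_top M) G"
    unfolding G_def by (intro openin_chart_vimage \<phi> open_ball)
  moreover have "x \<in> G" using \<phi> b(4) by (simp add: G_def)
  moreover have "restrict \<eta> (points M) y = 1" if "y \<in> G" for y
    using that b(5) openin_subset[OF \<open>openin (mfd_top M) G\<close>] by (auto simp: G_def \<eta>_def)
  ultimately show thesis
    using K \<open>K \<subseteq> U \<inter> N\<close> zero b(2)
    by (intro that[of "restrict \<eta> (points M)" K G]) (auto simp: \<eta>_def)
qed

text \<open>
  In a chart this is the mean value inequality on a small ball; the distance may be exchanged for
  the Euclidean one because the two are locally equivalent.
\<close>

lemma smooth_function_locally_Lipschitz:
  assumes d: "manifold_distance M d" and g: "smooth_function M (points M) g" and x: "x \<in> points M"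
  obtains N C where "openin (mfd_top M) N" "x \<in> N" "C > 0"
    "\<And>y z. y \<in> N \<Longrightarrow> z \<in> N \<Longrightarrow> \<bar>g y - g z\<bar> \<le> C * d y z" "\<And>y. y \<in> N \<Longrightarrow> \<bar>g y\<bar> \<le> C"
proof -
  obtain U \<phi> where \<phi>: "(U, \<phi>) \<in> atlas M" "x \<in> U"
    using x point_in_chart by blast
  have "\<forall>(U, \<phi>) \<in> atlas M. \<forall>x\<in>U. \<exists>N. openin (mfd_top M) N \<and> x \<in> N \<and> N \<subseteq> U \<and>
       (\<exists>A>0. \<exists>B>0. \<forall>y\<in>N. \<forall>z\<in>N.
          A * dist (\<phi> y) (\<phi> z) \<le> d y z \<and> d y z \<le> B * dist (\<phi> y) (\<phi> z))"
    using d unfolding manifold_distance_def by (elim conjE)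
  from bspec[OF this \<phi>(1)] \<phi>(2) have "\<exists>N A. openin (mfd_top M) N \<and> x \<in> N \<and> N \<subseteq> U \<and> A > 0 \<and>
      (\<forall>y\<in>N. \<forall>z\<in>N. A * dist (\<phi> y) (\<phi> z) \<le> d y z)"
    unfolding prod.case by metis
  then obtain N0 A where N0: "openin (mfd_top M) N0" "x \<in> N0" "N0 \<subseteq> U" "A > 0"
    and A: "\<And>y z. y \<in> N0 \<Longrightarrow> z \<in> N0 \<Longrightarrow> A * dist (\<phi> y) (\<phi> z) \<le> d y z"
    by blast
  obtain \<rho> where \<rho>: "\<rho> > 0" "cball (\<phi> x) \<rho> \<inter> model_space M \<subseteq> \<phi> ` (U \<inter> N0)"
    using chart_cball[OF \<phi>(1) N0(1) \<phi>(2) N0(2)] by blast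
  define C where "C = cball (\<phi> x) \<rho> \<inter> model_space M"
  have "compact C" "convex C" "C \<subseteq> model_space M"
    unfolding C_def
    by (simp_all add: compact_Int_closed closed_subspace convex_Int subspace_imp_convex subspace_model_space)
  moreover have "U \<inter> points M = U"
    using openin_subset[OF chartD(1)[OF \<phi>(1)]] by blast
  then have "Cinf_on (model_space M) (\<phi> ` U) (g \<circ> inv_into U \<phi>)"
    using bspec[OF g[unfolded smooth_function_def] \<phi>(1)] by simp
  then have "Ck_on (model_space M) 1 (\<phi> ` U) (g \<circ> inv_into U \<phi>)"
    unfolding Cinf_on_def by blast
  then have "Ck_on (model_space M) 1 C (g \<circ> inv_into U \<phi>)"
    by (rule Ck_on_subset) (use \<rho>(2) C_def in blast)
  ultimately obtain L where L: "L > 0"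
    "\<And>v w. v \<in> C \<Longrightarrow> w \<in> C \<Longrightarrow> \<bar>(g \<circ> inv_into U \<phi>) v - (g \<circ> inv_into U \<phi>) w\<bar> \<le> L * dist v w"
    "\<And>v. v \<in> C \<Longrightarrow> \<bar>(g \<circ> inv_into U \<phi>) v\<bar> \<le> L"
    using Ck_on_bounded_Lipschitz[OF subspace_model_space] by metis
  define N where "N = N0 \<inter> {y \<in> U. \<phi> y \<in> ball (\<phi> x) \<rho>}"
  have NC: "\<phi> y \<in> C" if "y \<in> N" for y
    using that chart_image_subset[OF \<phi>(1)] by (auto simp: N_def C_def)
  have inv: "inv_into U \<phi> (\<phi> y) = y" if "y \<in> N" for y
    using that inj_on_chart[OF \<phi>(1)] by (simp add: N_def)
  have pos: "L / A > 0" using L(1) N0(4) by simp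
  show thesis
  proof
    show "openin (mfd_top M) N"
      unfolding N_def by (intro openin_Int N0 openin_chart_vimage \<phi> open_ball)
    show "x \<in> N" using \<phi> N0 \<rho> by (simp add: N_def)
    show "L + L / A > 0" using L(1) pos by linarith
    show "\<bar>g y - g z\<bar> \<le> (L + L / A) * d y z" if yz: "y \<in> N" "z \<in> N" for y z
    proof -
      have "\<bar>g y - g z\<bar> \<le> L * dist (\<phi> y) (\<phi> z)"
        using L(2)[OF NC NC, OF yz] inv yz by simp
      also have "\<dots> = (L / A) * (A * dist (\<phi> y) (\<phi> z))" using N0(4) by simp
      also have "\<dots> \<le> (L / A) * d y z"
        using A yz pos by (intro mult_left_mono) (auto simp: N_def)
      also have "\<dots> \<le> (L + L / A) * d y z"
      proof (rule mult_right_mono)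
        have "0 \<le> A * dist (\<phi> y) (\<phi> z)" using N0(4) by simp
        also have "\<dots> \<le> d y z" using A yz by (simp add: N_def)
        finally show "0 \<le> d y z" .
      qed (use L(1) in simp)
      finally show ?thesis .
    qed
    show "\<bar>g y\<bar> \<le> L + L / A" if "y \<in> N" for y
      using L(3)[OF NC[OF that]] inv[OF that] pos by simp
  qed
qed

text \<open>
  Let \<open>g\<close> be Lipschitz and bounded on a ball of radius \<open>r\<close> about \<open>x\<close>, and let \<open>y\<close> lie in the
  ball of radius \<open>r/2\<close>. A zero \<open>z\<close> closer than \<open>r/2\<close> to \<open>y\<close> is within reach of the Lipschitz
  estimate. For any other zero \<open>d y z\<close> is bounded below, so that boundedness of \<open>g\<close> suffices.
  If \<open>Z\<close> is empty, the distance is 1 by convention and boundedness of \<open>g\<close> is the claim.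
\<close>

lemma vanishing_bounded_by_distance:
  assumes d: "manifold_distance M d" and g: "smooth_function M (points M) g" and x: "x \<in> points M"
    and Z: "Z \<subseteq> points M" "\<And>z. z \<in> Z \<Longrightarrow> g z = 0"
  obtains N C where "openin (mfd_top M) N" "x \<in> N" "C > 0"
    "\<And>y. y \<in> N \<Longrightarrow> \<bar>g y\<bar> \<le> C * set_distance d y Z"
proof -
  interpret Metric_space "points M" d
    using d unfolding manifold_distance_def by (elim conjE)
  have top: "mtopology = mfd_top M"
    using d unfolding manifold_distance_def by (elim conjE)
  obtain N C where N: "openin (mfd_top M) N" "x \<in> N" "C > 0"
    and Lip: "\<And>y z. y \<in> N \<Longrightarrow> z \<in> N \<Longrightarrow> \<bar>g y - g z\<bar> \<le> C * d y z"
    and bd: "\<And>y. y \<in> N \<Longrightarrow> \<bar>g y\<bar> \<le> C"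
    using smooth_function_locally_Lipschitz[OF d g x] by metis
  have "openin mtopology N" using N(1) by (simp only: top)
  then obtain r where r: "r > 0" "mball x r \<subseteq> N"
    using N(2) openin_mtopology by blast
  define C' where "C' = C + 2 * C / r"
  have C': "C' > 0" "C \<le> C'" "2 * C / r \<le> C'"
    using N(3) r(1) by (simp_all add: C'_def add_pos_pos)
  show thesis
  proof
    show "openin (mfd_top M) (mball x (r / 2))" using openin_mball[of x "r / 2"] by (simp only: top)
    show "x \<in> mball x (r / 2)" using x r(1) by simp
    show "C' > 0" by fact
    fix y assume y: "y \<in> mball x (r / 2)"
    then have yM: "y \<in> points M" and dy: "d x y < r / 2" by auto
    have yN: "y \<in> N" using r x yM dy by (auto simp: subset_iff)
    have le: "\<bar>g y\<bar> \<le> C' * d y z" if z: "z \<in> Z" for z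
    proof -
      have zM: "z \<in> points M" using z Z by blast
      show ?thesis
      proof (cases "d y z < r / 2")
        case True
        then have "d x z < r" using triangle[OF x yM zM] dy by linarith
        then have "z \<in> N" using r(2) x zM by auto
        then have "\<bar>g y\<bar> \<le> C * d y z" using Lip[OF yN] Z(2)[OF z] by fastforce
        also have "\<dots> \<le> C' * d y z" using C' by (intro mult_right_mono) auto
        finally show ?thesis .
      next
        case False
        have "\<bar>g y\<bar> \<le> (2 * C / r) * (r / 2)" using bd[OF yN] r(1) by simp
        also have "\<dots> \<le> C' * d y z" using C' r(1) False by (intro mult_mono) auto
        finally show ?thesis .
      qed
    qed
    show "\<bar>g y\<bar> \<le> C' * set_distance d y Z"
    proof (cases "Z = {}")
      case True
      with bd[OF yN] C' show ?thesis by (simp add: set_distance_def)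
    next
      case False
      have "\<bar>g y\<bar> / C' \<le> (INF z\<in>Z. d y z)"
        using le C' False by (intro cINF_greatest) (auto simp: field_simps)
      with False C' show ?thesis by (simp add: set_distance_def field_simps)
    qed
  qed
qed

end

section \<open>The ring of germs\<close>
lemma germ_eqI:
  assumes "openin (mfd_top M) N" "x \<in> N" "N \<subseteq> U \<inter> W" "\<And>y. y \<in> N \<Longrightarrow> f y = h y"
  shows "germ M x U f = germ M x W h"
proof -
  have "germ M x U f \<subseteq> germ M x W h"
    if N: "openin (mfd_top M) N" "x \<in> N" "N \<subseteq> U \<inter> W" "\<And>y. y \<in> N \<Longrightarrow> f y = h y" for U W f h
  proof clarify
    fix U' f' assume "(U', f') \<in> germ M x U f"
    then obtain N' where N': "(U', f') \<in> local_functions M x" "openin (mfd_top M) N'" "x \<in> N'"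
      "N' \<subseteq> U \<inter> U'" "\<And>y. y \<in> N' \<Longrightarrow> f y = f' y"
      unfolding germ_def by blast
    have "openin (mfd_top M) (N \<inter> N')" using N(1) N'(2) by (rule openin_Int)
    moreover have "x \<in> N \<inter> N'" "N \<inter> N' \<subseteq> W \<inter> U'" using N N' by auto
    moreover have "\<forall>y\<in>N \<inter> N'. h y = f' y" using N(4) N'(5) by (metis Int_iff)
    ultimately show "(U', f') \<in> germ M x W h"
      unfolding germ_def using N'(1) by blast
  qed
  from this[of U W f h] this[of W U h f] assms show ?thesis by auto
qed

lemma germ_self: "(U, f) \<in> local_functions M x \<Longrightarrow> (U, f) \<in> germ M x U f"
  unfolding germ_def local_functions_def by blast

lemma Union_germ_binop:
  assumes "(U, f) \<in> local_functions M x" "(W, h) \<in> local_functions M x"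
  shows "(\<Union>(U', f')\<in>germ M x U f. \<Union>(W', h')\<in>germ M x W h.
      germ M x (U' \<inter> W') (\<lambda>y\<in>U' \<inter> W'. F (f' y) (h' y)))
    = germ M x (U \<inter> W) (\<lambda>y. F (f y) (h y))"
proof -
  have "germ M x (U' \<inter> W') (\<lambda>y\<in>U' \<inter> W'. F (f' y) (h' y)) = germ M x (U \<inter> W) (\<lambda>y. F (f y) (h y))"
    if f': "(U', f') \<in> germ M x U f" and h': "(W', h') \<in> germ M x W h" for U' f' W' h'
  proof -
    obtain N where N: "openin (mfd_top M) N" "x \<in> N" "N \<subseteq> U \<inter> U'" "\<And>y. y \<in> N \<Longrightarrow> f y = f' y"
      using f' unfolding germ_def by blast
    obtain L where L: "openin (mfd_top M) L" "x \<in> L" "L \<subseteq> W \<inter> W'" "\<And>y. y \<in> L \<Longrightarrow> h y = h' y"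
      using h' unfolding germ_def by blast
    show ?thesis
      by (rule germ_eqI[OF openin_Int[OF N(1) L(1)]]) (use N L in auto)
  qed
  then have "(\<Union>(U', f')\<in>germ M x U f. \<Union>(W', h')\<in>germ M x W h.
      germ M x (U' \<inter> W') (\<lambda>y\<in>U' \<inter> W'. F (f' y) (h' y)))
    = (\<Union>(U', f')\<in>germ M x U f. \<Union>(W', h')\<in>germ M x W h. germ M x (U \<inter> W) (\<lambda>y. F (f y) (h y)))"
    by (intro SUP_cong refl) auto
  also have "\<dots> = germ M x (U \<inter> W) (\<lambda>y. F (f y) (h y))"
    using germ_self[OF assms(1)] germ_self[OF assms(2)] by auto
  finally show ?thesis .
qed

text \<open>
  Local functions are required to be extensional. Computing with germs is easier with
  representatives whose values outside \<open>U\<close> are arbitrary, since these are closed under pointwise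
  operations without restricting the result.
\<close>

definition smooth_near ::
    "('a, 'e::euclidean_space) manifold \<Rightarrow> 'a \<Rightarrow> 'a set \<Rightarrow> ('a \<Rightarrow> real) \<Rightarrow> bool"
  where "smooth_near M x U f \<longleftrightarrow> openin (mfd_top M) U \<and> x \<in> U \<and> smooth_function M U f"

lemma smooth_near_const: "x \<in> points M \<Longrightarrow> smooth_near M x (points M) (\<lambda>y. c)"
  by (simp add: smooth_near_def smooth_function_const)

lemma smooth_near_uminus: "smooth_near M x U f \<Longrightarrow> smooth_near M x U (\<lambda>y. - f y)"
  by (simp add: smooth_near_def smooth_function_uminus)

lemma smooth_near_add:
  assumes "smooth_near M x U f" "smooth_near M x W h"
  shows "smooth_near M x (U \<inter> W) (\<lambda>y. f y + h y)"
  using assms unfolding smooth_near_def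
  by (auto intro!: smooth_function_add intro: smooth_function_subset)

lemma smooth_near_mult:
  assumes "smooth_near M x U f" "smooth_near M x W h"
  shows "smooth_near M x (U \<inter> W) (\<lambda>y. f y * h y)"
  using assms unfolding smooth_near_def
  by (auto intro!: smooth_function_mult intro: smooth_function_subset)

lemma germ_restrict: "smooth_near M x U f \<Longrightarrow> germ M x U (restrict f U) = germ M x U f"
  unfolding smooth_near_def by (intro germ_eqI[of M U]) auto

lemma smooth_nearD: "smooth_near M x U f \<Longrightarrow> openin (mfd_top M) U \<and> x \<in> U \<and> U \<subseteq> points M"
  unfolding smooth_near_def using openin_subset by blast

lemma smooth_near_global:
  "f \<in> carrier (\<E> M) \<Longrightarrow> x \<in> points M \<Longrightarrow> smooth_near M x (points M) f"
  by (simp add: smooth_near_def)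

lemma subset_genideal: "S \<subseteq> Idl\<^bsub>R\<^esub> S"
  unfolding genideal_def by blast

lemma zero_of_Lojasiewicz_radical:
  assumes "g \<in> Lojasiewicz_radical M \<bb>" "x \<in> points M" "\<And>f. f \<in> \<bb> \<Longrightarrow> f x = 0"
  shows "g x = 0"
proof -
  obtain f m where f: "f \<in> \<bb>" and "m \<ge> 1" "f x - g x ^ (2 * m) \<ge> 0"
    using assms(1,2) unfolding Lojasiewicz_radical_def by blast
  with assms(3)[OF f] have "g x ^ (2 * m) \<le> 0" by simp
  moreover have "g x ^ (2 * m) \<ge> 0" by (simp add: zero_le_even_power)
  ultimately have "g x ^ (2 * m) = 0" by simp
  then show ?thesis by simp
qed

context
  fixes M :: "('a, 'e::euclidean_space) manifold"
  assumes M: "smooth_manifold M"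
begin

lemma smooth_function_restrict: "smooth_function M U (restrict f U) \<longleftrightarrow> smooth_function M U f"
  by (rule smooth_function_cong[OF M]) simp

lemma restrict_local_function:
  "smooth_near M x U f \<Longrightarrow> (U, restrict f U) \<in> local_functions M x"
  by (simp add: smooth_near_def local_functions_def smooth_function_restrict)

lemma germ_eq_imp_eq:
  assumes "smooth_near M x U f" "smooth_near M x W h" "germ M x U f = germ M x W h"
  shows "f x = h x"
proof -
  have "(W, restrict h W) \<in> germ M x U f"
    using germ_self[OF restrict_local_function[OF assms(2)]] germ_restrict[OF assms(2)] assms(3)
    by simp
  then show ?thesis unfolding germ_def by auto
qed

lemma carrier_germ_ring:
  "A \<in> carrier (germ_ring M x) \<longleftrightarrow> (\<exists>U f. smooth_near M x U f \<and> A = germ M x U f)"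
proof
  assume "A \<in> carrier (germ_ring M x)"
  then obtain U f where "(U, f) \<in> local_functions M x" "A = germ M x U f"
    by (auto simp: germ_ring_def)
  then show "\<exists>U f. smooth_near M x U f \<and> A = germ M x U f"
    by (auto simp: local_functions_def smooth_near_def)
next
  assume "\<exists>U f. smooth_near M x U f \<and> A = germ M x U f"
  then obtain U f where "smooth_near M x U f" "A = germ M x U f" by blast
  then have "(U, restrict f U) \<in> local_functions M x" "A = germ M x U (restrict f U)"
    by (simp_all add: restrict_local_function germ_restrict)
  then show "A \<in> carrier (germ_ring M x)" by (force simp: germ_ring_def)
qed

lemma germ_in_carrier: "smooth_near M x U f \<Longrightarrow> germ M x U f \<in> carrier (germ_ring M x)"
  using carrier_germ_ring by blast

lemma germ_binop:
  assumes "smooth_near M x U f" "smooth_near M x W h"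
  shows "(\<Union>(U', f')\<in>germ M x U f. \<Union>(W', h')\<in>germ M x W h.
      germ M x (U' \<inter> W') (\<lambda>y\<in>U' \<inter> W'. F (f' y) (h' y)))
    = germ M x (U \<inter> W) (\<lambda>y. F (f y) (h y))"
proof -
  have "germ M x (U \<inter> W) (\<lambda>y. F (restrict f U y) (restrict h W y))
      = germ M x (U \<inter> W) (\<lambda>y. F (f y) (h y))"
    using assms unfolding smooth_near_def by (intro germ_eqI[of M "U \<inter> W"]) auto
  then show ?thesis
    using Union_germ_binop[OF restrict_local_function[OF assms(1)] restrict_local_function[OF assms(2)], of F]
      germ_restrict[OF assms(1)] germ_restrict[OF assms(2)] by simp
qed

lemma germ_add:
  "smooth_near M x U f \<Longrightarrow> smooth_near M x W h \<Longrightarrow>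
    germ M x U f \<oplus>\<^bsub>germ_ring M x\<^esub> germ M x W h = germ M x (U \<inter> W) (\<lambda>y. f y + h y)"
  using germ_binop[of x U f W h "(+)"] by (simp add: germ_ring_def)

lemma germ_mult:
  "smooth_near M x U f \<Longrightarrow> smooth_near M x W h \<Longrightarrow>
    germ M x U f \<otimes>\<^bsub>germ_ring M x\<^esub> germ M x W h = germ M x (U \<inter> W) (\<lambda>y. f y * h y)"
  using germ_binop[of x U f W h "(*)"] by (simp add: germ_ring_def)

lemma germ_zero: "x \<in> points M \<Longrightarrow> \<zero>\<^bsub>germ_ring M x\<^esub> = germ M x (points M) (\<lambda>y. 0)"
  using germ_restrict[OF smooth_near_const] by (simp add: germ_ring_def)

lemma germ_one: "x \<in> points M \<Longrightarrow> \<one>\<^bsub>germ_ring M x\<^esub> = germ M x (points M) (\<lambda>y. 1)"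
  using germ_restrict[OF smooth_near_const] by (simp add: germ_ring_def)

text \<open>
  An ideal generated by a set is the intersection of all ideals containing it, and only a ring
  has ideals: without the ring axioms for germs this intersection would be everything. All
  axioms hold because they hold for real numbers pointwise near \<open>x\<close>.
\<close>

lemma ring_germ_ring:
  assumes x: "x \<in> points M"
  shows "ring (germ_ring M x)" (is "ring ?R")
proof -
  note near = smooth_near_add smooth_near_mult smooth_near_const[OF x] smooth_near_uminus
  have eqI: "germ M x U f = germ M x W h"
    if "smooth_near M x U f" "smooth_near M x W h" "\<And>y. f y = h y" for U W f h
    using that smooth_nearD[of M x] by (intro germ_eqI[of M "U \<inter> W"]) blast+
  note ops = germ_add germ_mult germ_zero[OF x] germ_one[OF x]
  have add_closed: "A \<oplus>\<^bsub>?R\<^esub> B \<in> carrier ?R" if "A \<in> carrier ?R" "B \<in> carrier ?R" for A B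
    using that unfolding carrier_germ_ring by (metis germ_add smooth_near_add)
  have mult_closed: "A \<otimes>\<^bsub>?R\<^esub> B \<in> carrier ?R" if "A \<in> carrier ?R" "B \<in> carrier ?R" for A B
    using that unfolding carrier_germ_ring by (metis germ_mult smooth_near_mult)
  have zero_closed: "\<zero>\<^bsub>?R\<^esub> \<in> carrier ?R" and one_closed: "\<one>\<^bsub>?R\<^esub> \<in> carrier ?R"
    by (simp_all add: ops germ_in_carrier near)
  have rep: "\<exists>U f. smooth_near M x U f \<and> A = germ M x U f" if "A \<in> carrier ?R" for A
    using that carrier_germ_ring by blast
  have "abelian_group ?R"
  proof (rule abelian_groupI)
    fix A B C assume "A \<in> carrier ?R" "B \<in> carrier ?R" "C \<in> carrier ?R"
    then obtain U f V g W h where *: "smooth_near M x U f" "A = germ M x U f"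
      "smooth_near M x V g" "B = germ M x V g" "smooth_near M x W h" "C = germ M x W h"
      using rep by metis
    then show "A \<oplus>\<^bsub>?R\<^esub> B \<oplus>\<^bsub>?R\<^esub> C = A \<oplus>\<^bsub>?R\<^esub> (B \<oplus>\<^bsub>?R\<^esub> C)"
      by (simp add: ops near, intro eqI near) (simp_all add: algebra_simps)
  next
    fix A B assume "A \<in> carrier ?R" "B \<in> carrier ?R"
    then obtain U f V g where "smooth_near M x U f" "A = germ M x U f"
      "smooth_near M x V g" "B = germ M x V g"
      using rep by metis
    then show "A \<oplus>\<^bsub>?R\<^esub> B = B \<oplus>\<^bsub>?R\<^esub> A"
      by (simp add: ops near, intro eqI near) (simp_all add: algebra_simps)
  next
    fix A assume "A \<in> carrier ?R"
    then obtain U f where *: "smooth_near M x U f" "A = germ M x U f" using rep by metis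
    show "\<zero>\<^bsub>?R\<^esub> \<oplus>\<^bsub>?R\<^esub> A = A"
      using * smooth_nearD[OF *(1)] by (simp add: ops near, intro germ_eqI[of M U]) auto
    have "germ M x U (\<lambda>y. - f y) \<oplus>\<^bsub>?R\<^esub> A = \<zero>\<^bsub>?R\<^esub>"
      using * smooth_nearD[OF *(1)] by (simp add: ops near, intro germ_eqI[of M U]) auto
    then show "\<exists>B\<in>carrier ?R. B \<oplus>\<^bsub>?R\<^esub> A = \<zero>\<^bsub>?R\<^esub>"
      using germ_in_carrier[OF smooth_near_uminus[OF *(1)]] by blast
  qed (use add_closed zero_closed in auto)
  moreover have "monoid ?R"
  proof (rule monoidI)
    fix A B C assume "A \<in> carrier ?R" "B \<in> carrier ?R" "C \<in> carrier ?R"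
    then obtain U f V g W h where *: "smooth_near M x U f" "A = germ M x U f"
      "smooth_near M x V g" "B = germ M x V g" "smooth_near M x W h" "C = germ M x W h"
      using rep by metis
    then show "A \<otimes>\<^bsub>?R\<^esub> B \<otimes>\<^bsub>?R\<^esub> C = A \<otimes>\<^bsub>?R\<^esub> (B \<otimes>\<^bsub>?R\<^esub> C)"
      by (simp add: ops near, intro eqI near) (simp_all add: algebra_simps)
  next
    fix A assume "A \<in> carrier ?R"
    then obtain U f where *: "smooth_near M x U f" "A = germ M x U f" using rep by metis
    show "\<one>\<^bsub>?R\<^esub> \<otimes>\<^bsub>?R\<^esub> A = A"
      using * smooth_nearD[OF *(1)] by (simp add: ops near, intro germ_eqI[of M U]) auto
    show "A \<otimes>\<^bsub>?R\<^esub> \<one>\<^bsub>?R\<^esub> = A"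
      using * smooth_nearD[OF *(1)] by (simp add: ops near, intro germ_eqI[of M U]) auto
  qed (use mult_closed one_closed in auto)
  ultimately show ?thesis
  proof (rule ringI)
    fix A B C assume "A \<in> carrier ?R" "B \<in> carrier ?R" "C \<in> carrier ?R"
    then obtain U f V g W h where *: "smooth_near M x U f" "A = germ M x U f"
      "smooth_near M x V g" "B = germ M x V g" "smooth_near M x W h" "C = germ M x W h"
      using rep by metis
    then show "(A \<oplus>\<^bsub>?R\<^esub> B) \<otimes>\<^bsub>?R\<^esub> C = A \<otimes>\<^bsub>?R\<^esub> C \<oplus>\<^bsub>?R\<^esub> B \<otimes>\<^bsub>?R\<^esub> C"
      by (simp add: ops near, intro eqI near) (simp_all add: algebra_simps)
    from * show "C \<otimes>\<^bsub>?R\<^esub> (A \<oplus>\<^bsub>?R\<^esub> B) = C \<otimes>\<^bsub>?R\<^esub> A \<oplus>\<^bsub>?R\<^esub> C \<otimes>\<^bsub>?R\<^esub> B"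
      by (simp add: ops near, intro eqI near) (simp_all add: algebra_simps)
  qed
qed

definition vanishing_germs :: "'a \<Rightarrow> ('a set \<times> ('a \<Rightarrow> real)) set set" where
  "vanishing_germs x = {germ M x U f | U f. smooth_near M x U f \<and> f x = 0}"

lemma germ_vanishing_iff:
  assumes f: "smooth_near M x U f"
  shows "germ M x U f \<in> vanishing_germs x \<longleftrightarrow> f x = 0"
proof
  assume "germ M x U f \<in> vanishing_germs x"
  then obtain W h where "germ M x U f = germ M x W h" "smooth_near M x W h" "h x = 0"
    unfolding vanishing_germs_def by blast
  with germ_eq_imp_eq[OF f] show "f x = 0" by metis
next
  assume "f x = 0"
  with f show "germ M x U f \<in> vanishing_germs x" unfolding vanishing_germs_def by blast
qed

text \<open>
  This ideal tests membership: an ideal generated by germs vanishing at \<open>x\<close> is contained in it.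
\<close>

lemma ideal_vanishing_germs:
  assumes x: "x \<in> points M"
  shows "ideal (vanishing_germs x) (germ_ring M x)" (is "ideal ?I ?R")
proof -
  interpret ring ?R using ring_germ_ring[OF x] .
  have sub: "?I \<subseteq> carrier ?R"
    by (auto simp: vanishing_germs_def germ_in_carrier)
  have mult: "B \<otimes>\<^bsub>?R\<^esub> A \<in> ?I \<and> A \<otimes>\<^bsub>?R\<^esub> B \<in> ?I" if A: "A \<in> ?I" and B: "B \<in> carrier ?R" for A B
  proof -
    obtain U f W h where "smooth_near M x U f" "f x = 0" "A = germ M x U f"
      "smooth_near M x W h" "B = germ M x W h"
      using A B unfolding vanishing_germs_def carrier_germ_ring by blast
    then show ?thesis by (simp add: germ_mult germ_vanishing_iff smooth_near_mult)
  qed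
  show ?thesis
  proof (rule idealI[OF ring_germ_ring[OF x]])
    show "subgroup ?I (add_monoid ?R)"
    proof (rule add.subgroupI)
      show "?I \<subseteq> carrier ?R" by (rule sub)
      show "?I \<noteq> {}"
        using germ_vanishing_iff[OF smooth_near_const[OF x, of 0]] by auto
      show "\<ominus>\<^bsub>?R\<^esub> A \<in> ?I" if "A \<in> ?I" for A
      proof -
        have "A \<in> carrier ?R" using sub that by blast
        then have "\<ominus>\<^bsub>?R\<^esub> \<one>\<^bsub>?R\<^esub> \<otimes>\<^bsub>?R\<^esub> A = \<ominus>\<^bsub>?R\<^esub> A" by (simp add: l_minus)
        with mult[OF that a_inv_closed[OF one_closed]] show ?thesis by simp
      qed
      show "A \<oplus>\<^bsub>?R\<^esub> B \<in> ?I" if AB: "A \<in> ?I" "B \<in> ?I" for A B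
      proof -
        obtain U f where "smooth_near M x U f" "f x = 0" "A = germ M x U f"
          using AB(1) unfolding vanishing_germs_def by blast
        moreover obtain W h where "smooth_near M x W h" "h x = 0" "B = germ M x W h"
          using AB(2) unfolding vanishing_germs_def by blast
        ultimately show ?thesis by (simp add: germ_add germ_vanishing_iff smooth_near_add)
      qed
    qed
  qed (use mult in auto)
qed

section \<open>Saturation, Lojasiewicz radical and zero sets\<close>

lemma saturation_vanishes:
  assumes b: "\<bb> \<subseteq> carrier (\<E> M)" and g: "g \<in> saturation M \<bb>"
    and x: "x \<in> points M" "\<And>f. f \<in> \<bb> \<Longrightarrow> f x = 0"
  shows "g x = 0"
proof -
  have "germ M x (points M) ` \<bb> \<subseteq> vanishing_germs x"
    using b x by (auto simp: germ_vanishing_iff smooth_near_global subset_iff)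
  then have "Idl\<^bsub>germ_ring M x\<^esub> (germ M x (points M) ` \<bb>) \<subseteq> vanishing_germs x"
    using ideal_vanishing_germs[OF x(1)] unfolding genideal_def by blast
  then have "germ M x (points M) g \<in> vanishing_germs x"
    using g x(1) unfolding saturation_def by blast
  moreover have "g \<in> carrier (\<E> M)" using g unfolding saturation_def by blast
  ultimately show ?thesis using germ_vanishing_iff[of x] smooth_near_global[of g M x] x(1) by blast
qed

lemma smooth_algebra_mult_closed:
  assumes "f \<in> carrier (\<E> M)" "h \<in> carrier (\<E> M)"
  shows "(\<lambda>y\<in>points M. h y * f y) \<in> carrier (\<E> M)"
  using assms by (simp add: smooth_function_restrict smooth_function_mult)

lemma saturation_mult_closed:
  assumes f: "f \<in> saturation M \<bb>" and h: "h \<in> carrier (\<E> M)"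
  shows "(\<lambda>y\<in>points M. h y * f y) \<in> saturation M \<bb>"
proof -
  have fE: "f \<in> carrier (\<E> M)" using f by (auto simp: saturation_def)
  have "germ M x (points M) (\<lambda>y\<in>points M. h y * f y)
      \<in> Idl\<^bsub>germ_ring M x\<^esub> (germ M x (points M) ` \<bb>)" if x: "x \<in> points M" for x
  proof -
    note near = smooth_near_global[OF h x] smooth_near_global[OF fE x]
    have eq: "germ M x (points M) (\<lambda>y\<in>points M. h y * f y)
        = germ M x (points M) h \<otimes>\<^bsub>germ_ring M x\<^esub> germ M x (points M) f"
      using germ_mult[OF near] germ_restrict[OF smooth_near_mult[OF near]] by simp
    have f_Idl: "germ M x (points M) f \<in> Idl\<^bsub>germ_ring M x\<^esub> (germ M x (points M) ` \<bb>)"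
      using f x by (auto simp: saturation_def)
    show ?thesis
      unfolding eq genideal_def
    proof clarify
      fix I assume I: "ideal I (germ_ring M x)" "germ M x (points M) ` \<bb> \<subseteq> I"
      then have "germ M x (points M) f \<in> I" using f_Idl unfolding genideal_def by blast
      then show "germ M x (points M) h \<otimes>\<^bsub>germ_ring M x\<^esub> germ M x (points M) f \<in> I"
        using germ_in_carrier[OF near(1)] by (rule ideal.I_l_closed[OF I(1)])
    qed
  qed
  then show ?thesis
    using smooth_algebra_mult_closed[OF fE h] by (simp add: saturation_def)
qed

text \<open>
  Membership in a saturation may be tested germ by germ, so near \<open>x\<close> the function \<open>g\<close> may be replaced
  by \<open>h = \<eta> g\<close> with a cutoff function \<open>\<eta>\<close> supported in a compact set \<open>K\<close> near \<open>x\<close>. On \<open>K\<close> both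
  \<open>\<bar>g\<bar> \<le> C D\<close> and \<open>c D\<^sup>m \<le> \<bar>f\<bar>\<close> hold, \<open>D\<close> being the distance to \<open>Z\<close>. Hence
  \<open>h\<^sup>2\<^sup>m \<le> C\<^sup>2\<^sup>m D\<^sup>2\<^sup>m \<le> (C\<^sup>2\<^sup>m / c\<^sup>2) f\<^sup>2\<close>, an inequality that off \<open>K\<close> is trivial and therefore holds on
  all of the manifold, as the Lojasiewicz radical demands.
\<close>

lemma vanishing_in_saturated_radical:
  assumes d: "manifold_distance M d" and Z: "Z \<subseteq> points M"
    and f: "f \<in> saturation M \<bb>"
    and Loj: "\<And>K. compactin (mfd_top M) K \<Longrightarrow>
      \<exists>c>0. \<exists>m::nat. m \<ge> 1 \<and> (\<forall>x\<in>K. \<bar>f x\<bar> \<ge> c * set_distance d x Z ^ m)"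
    and g: "g \<in> vanishing_ideal M Z"
  shows "g \<in> saturation M (Lojasiewicz_radical M (saturation M \<bb>))"
proof -
  have gE: "g \<in> carrier (\<E> M)" and gZ: "\<And>z. z \<in> Z \<Longrightarrow> g z = 0"
    using g by (auto simp: vanishing_ideal_def)
  have gs: "smooth_function M (points M) g" using gE by simp
  have fE: "f \<in> carrier (\<E> M)" using f by (auto simp: saturation_def)
  have "germ M x (points M) g \<in> germ M x (points M) ` Lojasiewicz_radical M (saturation M \<bb>)"
    if x: "x \<in> points M" for x
  proof -
    obtain N C where N: "openin (mfd_top M) N" "x \<in> N" "C > 0"
      and gd: "\<And>y. y \<in> N \<Longrightarrow> \<bar>g y\<bar> \<le> C * set_distance d y Z"
      using vanishing_bounded_by_distance[OF M d gs x Z gZ] by blast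
    obtain \<eta> K G where \<eta>: "\<eta> \<in> carrier (\<E> M)"
        "\<And>y. y \<in> points M \<Longrightarrow> 0 \<le> \<eta> y \<and> \<eta> y \<le> 1"
        "\<And>y. y \<in> points M \<Longrightarrow> y \<notin> K \<Longrightarrow> \<eta> y = 0"
      and K: "compactin (mfd_top M) K" "K \<subseteq> N"
      and G: "openin (mfd_top M) G" "x \<in> G" "\<And>y. y \<in> G \<Longrightarrow> \<eta> y = 1"
      by (rule smooth_cutoff[OF M x N(1,2)]) blast
    obtain c m where c: "c > 0" and m: "m \<ge> 1"
      and fd: "\<And>y. y \<in> K \<Longrightarrow> \<bar>f y\<bar> \<ge> c * set_distance d y Z ^ m"
      using Loj[OF K(1)] by blast
    define h where "h = (\<lambda>y\<in>points M. \<eta> y * g y)"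
    define a where "a = C ^ (2 * m) / c\<^sup>2"
    define k where "k = (\<lambda>y\<in>points M. a * f y)"
    define F where "F = (\<lambda>y\<in>points M. k y * f y)"
    have "a \<ge> 0" using N(3) c by (simp add: a_def)
    have "k \<in> carrier (\<E> M)"
      using fE unfolding k_def
      by (simp add: smooth_function_restrict smooth_function_mult smooth_function_const)
    then have F: "F \<in> saturation M \<bb>"
      unfolding F_def using saturation_mult_closed[OF f] by blast
    have hE: "h \<in> carrier (\<E> M)"
      unfolding h_def by (rule smooth_algebra_mult_closed[OF gE \<eta>(1)])
    have "F y - h y ^ (2 * m) \<ge> 0" if y: "y \<in> points M" for y
    proof (cases "y \<in> K")
      case False
      with \<eta>(3)[OF y] y have "h y = 0" by (simp add: h_def)
      moreover have "F y \<ge> 0"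
        using y \<open>a \<ge> 0\<close> by (simp add: F_def k_def mult.assoc)
      ultimately show ?thesis using m by (simp add: zero_power)
    next
      case True
      then have "y \<in> N" using K(2) by blast
      define D where "D = set_distance d y Z"
      have gD: "\<bar>g y\<bar> \<le> C * D" using gd[OF \<open>y \<in> N\<close>] by (simp add: D_def)
      then have "0 \<le> C * D" by (rule order_trans[OF abs_ge_zero])
      then have "D \<ge> 0" using N(3) by (simp add: zero_le_mult_iff)
      have "\<bar>h y\<bar> \<le> \<bar>g y\<bar>"
        using \<eta>(2)[OF y] y by (simp add: h_def abs_mult mult_left_le_one_le)
      then have "\<bar>h y\<bar> \<le> C * D" using gD by linarith
      then have "\<bar>h y\<bar> ^ (2 * m) \<le> (C * D) ^ (2 * m)" by (rule power_mono) simp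
      then have "h y ^ (2 * m) \<le> (C * D) ^ (2 * m)" by (simp add: power_even_abs)
      also have "\<dots> = a * (c * D ^ m)\<^sup>2"
        using c by (simp add: a_def power_mult_distrib power_mult[symmetric] mult.commute)
      also have "\<dots> \<le> a * \<bar>f y\<bar>\<^sup>2"
        using fd[OF True] c \<open>D \<ge> 0\<close> \<open>a \<ge> 0\<close>
        by (intro mult_left_mono power_mono) (auto simp: D_def)
      also have "\<dots> = F y"
        using y by (simp add: F_def k_def power2_eq_square)
      finally show ?thesis by simp
    qed
    with F m hE have "h \<in> Lojasiewicz_radical M (saturation M \<bb>)"
      unfolding Lojasiewicz_radical_def by blast
    moreover have "germ M x (points M) g = germ M x (points M) h"
      using G openin_subset[OF G(1)] by (intro germ_eqI[of M G]) (auto simp: h_def)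
    ultimately show ?thesis by blast
  qed
  then have "germ M x (points M) g \<in> Idl\<^bsub>germ_ring M x\<^esub>
      (germ M x (points M) ` Lojasiewicz_radical M (saturation M \<bb>))" if "x \<in> points M" for x
    using that by (intro subsetD[OF subset_genideal])
  with gE show ?thesis by (simp add: saturation_def)
qed

theorem vanishing_ideal_eq_saturated_radical:
  assumes d: "manifold_distance M d" and a: "weakly_Lojasiewicz M d \<aa>"
  shows "vanishing_ideal M (zero_set M \<aa>) = saturation M (Lojasiewicz_radical M (saturation M \<aa>))"
proof
  have "ideal \<aa> (\<E> M)" using a by (simp add: weakly_Lojasiewicz_def)
  then have aE: "\<aa> \<subseteq> carrier (\<E> M)"
    by (intro additive_subgroup.a_subset ideal.axioms)
  show "saturation M (Lojasiewicz_radical M (saturation M \<aa>)) \<subseteq> vanishing_ideal M (zero_set M \<aa>)"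
  proof
    fix g assume g: "g \<in> saturation M (Lojasiewicz_radical M (saturation M \<aa>))"
    have "g x = 0" if x: "x \<in> zero_set M \<aa>" for x
    proof -
      have "x \<in> points M" "\<And>f. f \<in> \<aa> \<Longrightarrow> f x = 0" using x by (auto simp: zero_set_def)
      then have "\<And>f. f \<in> saturation M \<aa> \<Longrightarrow> f x = 0"
        using saturation_vanishes[OF aE] by blast
      then have "\<And>h. h \<in> Lojasiewicz_radical M (saturation M \<aa>) \<Longrightarrow> h x = 0"
        using zero_of_Lojasiewicz_radical[of _ M "saturation M \<aa>" x] \<open>x \<in> points M\<close> by blast
      moreover have "Lojasiewicz_radical M (saturation M \<aa>) \<subseteq> carrier (\<E> M)"
        unfolding Lojasiewicz_radical_def by blast
      ultimately show ?thesis
        using saturation_vanishes[OF _ g \<open>x \<in> points M\<close>] by blast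
    qed
    then show "g \<in> vanishing_ideal M (zero_set M \<aa>)"
      using g unfolding vanishing_ideal_def saturation_def by blast
  qed
  obtain f where "f \<in> saturation M \<aa>" "\<And>K. compactin (mfd_top M) K \<Longrightarrow>
      \<exists>c>0. \<exists>m::nat. m \<ge> 1 \<and> (\<forall>x\<in>K. \<bar>f x\<bar> \<ge> c * set_distance d x (zero_set M \<aa>) ^ m)"
    using a unfolding weakly_Lojasiewicz_def by blast
  moreover have "zero_set M \<aa> \<subseteq> points M" by (auto simp: zero_set_def)
  ultimately show "vanishing_ideal M (zero_set M \<aa>) \<subseteq> saturation M (Lojasiewicz_radical M (saturation M \<aa>))"
    using vanishing_in_saturated_radical[OF d] by blast
qed

end

theorem theorem12:
  fixes M :: "('a, 'e::euclidean_space) manifold"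
    and d :: "'a \<Rightarrow> 'a \<Rightarrow> real"
    and \<aa> :: "('a \<Rightarrow> real) set"
  assumes "smooth_manifold M"
    and "manifold_distance M d"
    and "weakly_Lojasiewicz M d \<aa>"
  shows "(saturated M \<aa> \<longrightarrow>
            vanishing_ideal M (zero_set M \<aa>) = saturation M (Lojasiewicz_radical M \<aa>)) \<and>
         (\<not> saturated M \<aa> \<longrightarrow>
            vanishing_ideal M (zero_set M \<aa>) =
              saturation M (Lojasiewicz_radical M (saturation M \<aa>)))"
proof (intro conjI impI)
  note main = vanishing_ideal_eq_saturated_radical[OF assms]
  show "vanishing_ideal M (zero_set M \<aa>) = saturation M (Lojasiewicz_radical M \<aa>)"
    if "saturated M \<aa>"
    using main that[unfolded saturated_def, symmetric] by simp
  show "vanishing_ideal M (zero_set M \<aa>) =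
      saturation M (Lojasiewicz_radical M (saturation M \<aa>))"
    by (rule main)
qed

end
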